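(* Let $L$ be a non-empty finite boolean lattice, let $1=\max(L)$ and let $r=\operatorname{rk}(L)$. For each $n\in\mathbb{Z}$, let $D_n=\{x\in L:\operatorname{rk}(x)=r-n\}$. Let $\mathcal{F}\colon L\to\mathrm{Ab}$ be a functor. Let $\mathcal{E}=(E_\ast,d^{\mathcal{E}}_\ast)$ be the chain complex defined by $E_n=\bigoplus_{x\in D_n}\mathcal{F}(x)$ for $n\in\mathbb{N}_0$, $E_n=0$ for $n<0$, with differentials $d^{\mathcal{E}}_n\colon E_n\to E_{n-1}$ defined by $d^{\mathcal{E}}_n(\lambda)=\sum\varepsilon(x\prec y)\,\mathcal{F}(x\le y)(\lambda)$ for $x\in D_n$ and $\lambda\in\mathcal{F}(x)$, where the sum runs over the elements $y$ which cover $x$. Then $H_n(L,L-\{1\};\mathcal{F})\cong H_n(\mathcal{E})$ for all $n\in\mathbb{Z}$.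
   Context: $\mathrm{Ab}$ is the category of abelian groups. A poset $X$ is regarded as a small category with a unique morphism $x\to y$ iff $x\le y$; functors are covariant. For $n\ge 0$, $\mathrm{Ch}_n(X)$ is the set of totally ordered subsets of $X$ of cardinality $n+1$. For a functor $\mathcal{F}\colon X\to\mathrm{Ab}$, $C(X;\mathcal{F})$ is the chain complex with $C_n(X;\mathcal{F})=\bigoplus_{\sigma\in \mathrm{Ch}_n(X)}\mathcal{F}(\min\sigma)$ for $n\geq 0$ (and $0$ for $n<0$), whose differential for $n\geq 1$ is given, for $\sigma=\{\sigma_0<\dots<\sigma_n\}$ and $g\in\mathcal{F}(\sigma_0)$, by $d(g\sigma)=\mathcal{F}(\sigma_0<\sigma_1)(g)\,(\sigma-\{\sigma_0\})+\sum_{i=1}^n(-1)^i g\,(\sigma-\{\sigma_i\})$. For a subposet $A\subseteq X$, $H_n(X,A;\mathcal{F})$ is the homology of the quotient complex $C(X;\mathcal{F})/C(A;\mathcal{F}|_A)$. For a finite boolean lattice $L$ and $x\in L$, $\operatorname{rk}(x)$ is the number of atoms of $L$ that are $\le x$ (equivalently, one fewer than the maximum cardinality of a chain in $\{y\in L:y\le x\}$), and $\operatorname{rk}(L)=\operatorname{rk}(\max L)$. A total ordering of the atoms of $L$ is fixed, which determines an isomorphism of posets $\phi\colon L\to\{0,1\}^{\operatorname{rk}(L)}$, with the product order ($0\le1$); $\phi_j$ is the $j$-th coordinate of $\phi$. $x\prec y$ means that $y$ covers $x$. If $x\prec y$, there is a unique $m_{xy}$ with $\phi_{m_{xy}}(x)=0$,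 $\phi_{m_{xy}}(y)=1$ and $\phi_j(x)=\phi_j(y)$ for $j\ne m_{xy}$; the sign of the cover relation is $\varepsilon(x\prec y)=\prod_{j=1}^{m_{xy}}(-1)^{\phi_j(x)}$. *)

theory Defs
  imports "HOL-Algebra.Free_Abelian_Groups"
begin

text \<open>
  Abelian groups are \<^const>\<open>comm_group\<close>s, hence written multiplicatively: a sum is a
  \<^const>\<open>finprod\<close>, the multiple \<open>k g\<close> is the power \<open>g [^] k\<close> with an integer exponent, and
  \<open>0\<close> is \<open>\<one>\<close>. The elements of a direct sum \<^const>\<open>sum_group\<close> are functions.
\<close>

text \<open>A chain complex is given by groups \<open>C n\<close> and maps \<open>d n\<close> from \<open>C n\<close> to \<open>C (n - 1)\<close>.\<close>

definition homology :: "(int \<Rightarrow> 'c monoid) \<Rightarrow> (int \<Rightarrow> 'c \<Rightarrow> 'c) \<Rightarrow> int \<Rightarrow> 'c set monoid" where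
  "homology C d n =
     (C n)\<lparr>carrier := kernel (C n) (C (n - 1)) (d n)\<rparr> Mod (d (n + 1) ` carrier (C (n + 1)))"

definition quotient_group ::
    "(int \<Rightarrow> 'c monoid) \<Rightarrow> (int \<Rightarrow> 'c set) \<Rightarrow> int \<Rightarrow> 'c set monoid" where
  "quotient_group C B n = C n Mod B n"

text \<open>The induced differential: the coset of \<open>c\<close> is sent to the coset of \<open>d n c\<close>.\<close>

definition quotient_diff ::
    "(int \<Rightarrow> 'c monoid) \<Rightarrow> (int \<Rightarrow> 'c \<Rightarrow> 'c) \<Rightarrow> (int \<Rightarrow> 'c set) \<Rightarrow> int \<Rightarrow> 'c set \<Rightarrow> 'c set" where
  "quotient_diff C d B n S = the_elem ((\<lambda>c. B (n - 1) #>\<^bsub>C (n - 1)\<^esub> d n c) ` S)"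

definition summand_incl ::
    "'i set \<Rightarrow> ('i \<Rightarrow> ('b, 'm) monoid_scheme) \<Rightarrow> 'i \<Rightarrow> 'b \<Rightarrow> 'i \<Rightarrow> 'b" where
  "summand_incl I G i g = (\<lambda>j\<in>I. if j = i then g else \<one>\<^bsub>G j\<^esub>)"

text \<open>\<open>f x y\<close> is the value of the functor on the morphism \<open>x \<le> y\<close>.\<close>

definition ab_functor ::
    "'a::order set \<Rightarrow> ('a \<Rightarrow> 'b monoid) \<Rightarrow> ('a \<Rightarrow> 'a \<Rightarrow> 'b \<Rightarrow> 'b) \<Rightarrow> bool" where
  "ab_functor X F f \<longleftrightarrow>
     (\<forall>x\<in>X. comm_group (F x)) \<and>
     (\<forall>x\<in>X. \<forall>y\<in>X. x \<le> y \<longrightarrow> f x y \<in> hom (F x) (F y)) \<and>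
     (\<forall>x\<in>X. \<forall>g\<in>carrier (F x). f x x g = g) \<and>
     (\<forall>x\<in>X. \<forall>y\<in>X. \<forall>z\<in>X. x \<le> y \<longrightarrow> y \<le> z \<longrightarrow>
        (\<forall>g\<in>carrier (F x). f x z g = f y z (f x y g)))"

text \<open>
  For negative \<open>n\<close> the index set is empty (in particular the empty chain is excluded), so that
  the direct sum indexed by it is the trivial group.
\<close>

definition Ch :: "'a::order set \<Rightarrow> int \<Rightarrow> 'a set set" where
  "Ch X n = (if n < 0 then {}
     else {\<sigma>. \<sigma> \<subseteq> X \<and> Complete_Partial_Order.chain (\<le>) \<sigma> \<and> finite \<sigma> \<and> int (card \<sigma>) = n + 1})"

text \<open>\<open>vertex \<sigma> i\<close> is \<open>\<sigma>\<^sub>i\<close> where \<open>\<sigma> = {\<sigma>\<^sub>0 < \<dots> < \<sigma>\<^sub>n}\<close>; thus \<open>min \<sigma>\<close> is \<open>vertex \<sigma> 0\<close>.\<close>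

definition vertex :: "'a::order set \<Rightarrow> nat \<Rightarrow> 'a" where
  "vertex \<sigma> i = (THE x. x \<in> \<sigma> \<and> card {y \<in> \<sigma>. y < x} = i)"

definition C_group ::
    "'a::order set \<Rightarrow> ('a \<Rightarrow> 'b monoid) \<Rightarrow> int \<Rightarrow> ('a set \<Rightarrow> 'b) monoid" where
  "C_group X F n = sum_group (Ch X n) (\<lambda>\<sigma>. F (vertex \<sigma> 0))"

definition C_incl ::
    "'a::order set \<Rightarrow> ('a \<Rightarrow> 'b monoid) \<Rightarrow> int \<Rightarrow> 'a set \<Rightarrow> 'b \<Rightarrow> 'a set \<Rightarrow> 'b" where
  "C_incl X F n = summand_incl (Ch X n) (\<lambda>\<sigma>. F (vertex \<sigma> 0))"

definition C_diff_summand ::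
    "'a::order set \<Rightarrow> ('a \<Rightarrow> 'b monoid) \<Rightarrow> ('a \<Rightarrow> 'a \<Rightarrow> 'b \<Rightarrow> 'b) \<Rightarrow> int \<Rightarrow>
     'a set \<Rightarrow> 'b \<Rightarrow> ('a set \<Rightarrow> 'b)" where
  "C_diff_summand X F f n \<sigma> g =
     C_incl X F (n - 1) (\<sigma> - {vertex \<sigma> 0}) (f (vertex \<sigma> 0) (vertex \<sigma> 1) g)
     \<otimes>\<^bsub>C_group X F (n - 1)\<^esub>
     finprod (C_group X F (n - 1))
       (\<lambda>i. C_incl X F (n - 1) (\<sigma> - {vertex \<sigma> i}) (g [^]\<^bsub>F (vertex \<sigma> 0)\<^esub> ((-1::int) ^ i)))
       {1..nat n}"

definition C_diff ::
    "'a::order set \<Rightarrow> ('a \<Rightarrow> 'b monoid) \<Rightarrow> ('a \<Rightarrow> 'a \<Rightarrow> 'b \<Rightarrow> 'b) \<Rightarrow> int \<Rightarrow>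
     ('a set \<Rightarrow> 'b) \<Rightarrow> ('a set \<Rightarrow> 'b)" where
  "C_diff X F f n c =
     (if n \<le> 0 then \<one>\<^bsub>C_group X F (n - 1)\<^esub>
      else gfinprod (C_group X F (n - 1)) (\<lambda>\<sigma>. C_diff_summand X F f n \<sigma> (c \<sigma>)) (Ch X n))"

text \<open>The image of \<open>C\<^sub>n(A; F|\<^sub>A)\<close> in \<open>C\<^sub>n(X; F)\<close>, by extending with \<open>\<one>\<close>, for \<open>A \<subseteq> X\<close>.\<close>

definition C_sub ::
    "'a::order set \<Rightarrow> 'a set \<Rightarrow> ('a \<Rightarrow> 'b monoid) \<Rightarrow> int \<Rightarrow> ('a set \<Rightarrow> 'b) set" where
  "C_sub X A F n =
     (\<lambda>c. \<lambda>\<sigma>\<in>Ch X n. if \<sigma> \<in> Ch A n then c \<sigma> else \<one>\<^bsub>F (vertex \<sigma> 0)\<^esub>) ` carrier (C_group A F n)"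

definition rel_homology ::
    "'a::order set \<Rightarrow> 'a set \<Rightarrow> ('a \<Rightarrow> 'b monoid) \<Rightarrow> ('a \<Rightarrow> 'a \<Rightarrow> 'b \<Rightarrow> 'b) \<Rightarrow> int \<Rightarrow>
     ('a set \<Rightarrow> 'b) set set monoid" where
  "rel_homology X A F f =
     homology (quotient_group (C_group X F) (C_sub X A F))
              (quotient_diff (C_group X F) (C_diff X F f) (C_sub X A F))"

definition atoms :: "'a::order_bot set" where
  "atoms = {a. a \<noteq> bot \<and> (\<forall>y. y < a \<longrightarrow> y = bot)}"

definition rk :: "'a::order_bot \<Rightarrow> nat" where
  "rk x = card {a \<in> atoms. a \<le> x}"

definition covered_by :: "'a::order \<Rightarrow> 'a \<Rightarrow> bool" where
  "covered_by x y \<longleftrightarrow> x < y \<and> (\<nexists>z. x < z \<and> z < y)"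

text \<open>
  The total order \<open>R\<close> on the atoms (\<open>(a, b) \<in> R\<close> meaning that \<open>a\<close> is before or equal to \<open>b\<close>)
  enumerates them as \<open>a\<^sub>1, \<dots>, a\<^sub>r\<close>. The isomorphism with \<open>{0,1}\<^sup>r\<close> it determines is the one
  that sends \<open>a\<^sub>j\<close> to the \<open>j\<close>-th unit vector; its \<open>j\<close>-th coordinate \<open>coord R j\<close> therefore
  tests whether \<open>a\<^sub>j \<le> x\<close>. Coordinates are indexed from \<open>1\<close> to \<open>r\<close>.
\<close>

definition nth_atom :: "('a::order_bot \<times> 'a) set \<Rightarrow> nat \<Rightarrow> 'a" where
  "nth_atom R j = (THE a. a \<in> atoms \<and> card {b \<in> atoms. (b, a) \<in> R} = j)"

definition coord :: "('a::order_bot \<times> 'a) set \<Rightarrow> nat \<Rightarrow> 'a \<Rightarrow> nat" where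
  "coord R j x = (if nth_atom R j \<le> x then 1 else 0)"

definition cover_index :: "('a::{order_bot, order_top} \<times> 'a) set \<Rightarrow> 'a \<Rightarrow> 'a \<Rightarrow> nat" where
  "cover_index R x y =
     (THE m. m \<in> {1..rk (Orderings.top :: 'a)} \<and> coord R m x = 0 \<and> coord R m y = 1 \<and>
             (\<forall>j\<in>{1..rk (Orderings.top :: 'a)}. j \<noteq> m \<longrightarrow> coord R j x = coord R j y))"

definition cover_sign :: "('a::{order_bot, order_top} \<times> 'a) set \<Rightarrow> 'a \<Rightarrow> 'a \<Rightarrow> int" where
  "cover_sign R x y = (\<Prod>j = 1..cover_index R x y. (-1) ^ coord R j x)"

definition D :: "int \<Rightarrow> 'a::{order_bot, order_top} set" where
  "D n = {x. int (rk x) = int (rk (Orderings.top :: 'a)) - n}"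

definition E_group ::
    "('a::{order_bot, order_top} \<Rightarrow> 'b monoid) \<Rightarrow> int \<Rightarrow> ('a \<Rightarrow> 'b) monoid" where
  "E_group F n = sum_group (if n < 0 then {} else D n) F"

definition E_incl ::
    "('a::{order_bot, order_top} \<Rightarrow> 'b monoid) \<Rightarrow> int \<Rightarrow> 'a \<Rightarrow> 'b \<Rightarrow> 'a \<Rightarrow> 'b" where
  "E_incl F n = summand_incl (if n < 0 then {} else D n) F"

definition E_diff_summand ::
    "('a::{order_bot, order_top} \<times> 'a) set \<Rightarrow> ('a \<Rightarrow> 'b monoid) \<Rightarrow>
     ('a \<Rightarrow> 'a \<Rightarrow> 'b \<Rightarrow> 'b) \<Rightarrow> int \<Rightarrow> 'a \<Rightarrow> 'b \<Rightarrow> ('a \<Rightarrow> 'b)" where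
  "E_diff_summand R F f n x g =
     finprod (E_group F (n - 1))
       (\<lambda>y. E_incl F (n - 1) y (f x y g [^]\<^bsub>F y\<^esub> cover_sign R x y)) {y. covered_by x y}"

definition E_diff ::
    "('a::{order_bot, order_top} \<times> 'a) set \<Rightarrow> ('a \<Rightarrow> 'b monoid) \<Rightarrow>
     ('a \<Rightarrow> 'a \<Rightarrow> 'b \<Rightarrow> 'b) \<Rightarrow> int \<Rightarrow> ('a \<Rightarrow> 'b) \<Rightarrow> ('a \<Rightarrow> 'b)" where
  "E_diff R F f n c =
     gfinprod (E_group F (n - 1)) (\<lambda>x. E_diff_summand R F f n x (c x))
       (if n < 0 then {} else D n)"

end

theory Submission
  imports Defs
begin

text \<open>
  Chains containing \<open>1\<close>, labelled by their minimum, are a basis of the relative complex; elements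
  of \<open>L\<close>, labelled by themselves, are a basis of \<open>\<E>\<close>. In both cases the differential is an integer
  matrix \<open>M\<close> with \<open>M i j \<noteq> 0\<close> only if the label of \<open>i\<close> is \<open>\<le>\<close> that of \<open>j\<close>, and \<open>F\<close> only enters
  by transporting coefficients along labels. Composition then becomes the matrix product, so it
  suffices to compare the two complexes of integer matrices. For each \<open>x \<noteq> 1\<close> the basis elements
  with label \<open>\<ge> x\<close> span an exact complex: for chains by coning with \<open>x\<close>, for \<open>\<E>\<close> by coning with an
  atom \<open>m\<close> not below \<open>x\<close>, i.e. sending \<open>y \<ge> m\<close> to \<open>y\<close> with \<open>m\<close> removed. Both have a single basis
  element in degree \<open>0\<close>, labelled \<open>1\<close>. The comparison theorem for projective resolutions yields
  mutually inverse homotopy equivalences.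
\<close>

section \<open>Label-monotone integer matrices and the comparison theorem\<close>

text \<open>A direct comparison would have to lift elements of the groups \<open>F x\<close>, which
  in general have no lifting property. Free abelian groups do, so every choice is made among integer
  matrices, before \<open>F\<close> enters. Row \<open>i\<close> of a matrix is the image of
  generator \<open>i\<close>, and products are read from left to right. A row labelled
  \<open>x\<close> may only involve generators labelled \<open>\<ge> x\<close>, because
  \<open>F\<close> has maps in the upward direction only; lifting that row requires exactness of
  precisely that part of the target. For \<open>x = 1\<close> this part is one copy of the integers
  in degree \<open>0\<close>, which is not exact; but rows labelled \<open>1\<close> occur only in
  degree \<open>0\<close>, where the matrix is prescribed to be \<open>1\<close>. No chain map
  between the two complexes is written down explicitly: the signs of the cover relations matter only
  through \<open>d d = 0\<close> and through the contraction. In homological terms, both complexes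
  compute Tor over the poset of \<open>F\<close> and the contravariant functor that is the integers
  at \<open>1\<close> and zero elsewhere.\<close>

definition mat_prod :: "'j set \<Rightarrow> ('i \<Rightarrow> 'j \<Rightarrow> int) \<Rightarrow> ('j \<Rightarrow> 'k \<Rightarrow> int) \<Rightarrow> 'i \<Rightarrow> 'k \<Rightarrow> int" where
  "mat_prod A M N i k = (\<Sum>j\<in>A. M i j * N j k)"

lemma mat_prod_assoc: "mat_prod B (mat_prod A M N) P = mat_prod A M (mat_prod B N P)"
proof (intro ext)
  fix i k
  have "mat_prod B (mat_prod A M N) P i k = (\<Sum>b\<in>B. \<Sum>a\<in>A. M i a * N a b * P b k)"
    by (simp add: mat_prod_def sum_distrib_right)
  also have "\<dots> = (\<Sum>a\<in>A. \<Sum>b\<in>B. M i a * N a b * P b k)"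
    by (rule sum.swap)
  also have "\<dots> = mat_prod A M (mat_prod B N P) i k"
    by (simp add: mat_prod_def sum_distrib_left mult.assoc)
  finally show "mat_prod B (mat_prod A M N) P i k = mat_prod A M (mat_prod B N P) i k" .
qed

lemma mat_prod_cong:
  assumes "\<And>j. j \<in> A \<Longrightarrow> M i j = M' i j" and "\<And>j. j \<in> A \<Longrightarrow> N j k = N' j k"
  shows "mat_prod A M N i k = mat_prod A M' N' i k"
  unfolding mat_prod_def using assms by (intro sum.cong) auto

lemma mat_prod_zero [simp]:
  "mat_prod A (\<lambda>i j. 0) N i k = 0" "mat_prod A M (\<lambda>j k. 0) i k = 0" "mat_prod {} M N i k = 0"
  by (simp_all add: mat_prod_def)

lemma mat_prod_add_left:
  "mat_prod A (\<lambda>i j. M i j + M' i j) N i k = mat_prod A M N i k + mat_prod A M' N i k"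
  by (simp add: mat_prod_def distrib_right sum.distrib)

lemma mat_prod_add_right:
  "mat_prod A M (\<lambda>j k. N j k + N' j k) i k = mat_prod A M N i k + mat_prod A M N' i k"
  by (simp add: mat_prod_def distrib_left sum.distrib)

lemma mat_prod_diff_left:
  "mat_prod A (\<lambda>i j. M i j - M' i j) N i k = mat_prod A M N i k - mat_prod A M' N i k"
  by (simp add: mat_prod_def left_diff_distrib sum_subtractf)

lemma mat_prod_diff_right:
  "mat_prod A M (\<lambda>j k. N j k - N' j k) i k = mat_prod A M N i k - mat_prod A M N' i k"
  by (simp add: mat_prod_def right_diff_distrib sum_subtractf)

lemma mat_prod_scale_left: "mat_prod A (\<lambda>i j. c * M i j) N i k = c * mat_prod A M N i k"
  by (simp add: mat_prod_def sum_distrib_left mult.assoc)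

lemma mat_prod_scale_right: "mat_prod A M (\<lambda>j k. c * N j k) i k = c * mat_prod A M N i k"
  by (simp add: mat_prod_def sum_distrib_left mult.left_commute)

definition id_mat :: "'i \<Rightarrow> 'i \<Rightarrow> int" where
  "id_mat i j = (if i = j then 1 else 0)"

lemma mat_prod_id_left: "finite A \<Longrightarrow> i \<in> A \<Longrightarrow> mat_prod A id_mat N i k = N i k"
  by (simp add: mat_prod_def id_mat_def if_distrib [of "\<lambda>x. x * _"] sum.delta cong: if_cong)

lemma mat_prod_id_right: "finite A \<Longrightarrow> k \<in> A \<Longrightarrow> mat_prod A M id_mat i k = M i k"
  by (simp add: mat_prod_def id_mat_def if_distrib [of "\<lambda>x. _ * x"] sum.delta' cong: if_cong)

definition mat_mono ::
    "'i set \<Rightarrow> 'j set \<Rightarrow> ('i \<Rightarrow> 'a::order) \<Rightarrow> ('j \<Rightarrow> 'a) \<Rightarrow> ('i \<Rightarrow> 'j \<Rightarrow> int) \<Rightarrow> bool" where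
  "mat_mono A B l m M \<longleftrightarrow> (\<forall>i\<in>A. \<forall>j\<in>B. M i j \<noteq> 0 \<longrightarrow> l i \<le> m j)"

lemma mat_monoD: "mat_mono A B l m M \<Longrightarrow> i \<in> A \<Longrightarrow> j \<in> B \<Longrightarrow> M i j \<noteq> 0 \<Longrightarrow> l i \<le> m j"
  by (simp add: mat_mono_def)

lemma mat_mono_prod:
  assumes "mat_mono A B l m M" "mat_mono B C m q N"
  shows "mat_mono A C l q (mat_prod B M N)"
proof -
  have "l i \<le> q k" if "i \<in> A" "k \<in> C" "mat_prod B M N i k \<noteq> 0" for i k
  proof -
    from that(3) obtain j where "j \<in> B" "M i j * N j k \<noteq> 0"
      unfolding mat_prod_def by (meson sum.neutral)
    then show ?thesis
      using that assms by (fastforce simp: mat_mono_def intro: order_trans)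
  qed
  then show ?thesis by (simp add: mat_mono_def)
qed

lemma mat_mono_add:
  "mat_mono A B l m M \<Longrightarrow> mat_mono A B l m N \<Longrightarrow> mat_mono A B l m (\<lambda>i j. M i j + N i j)"
  by (fastforce simp: mat_mono_def)

lemma mat_mono_diff:
  "mat_mono A B l m M \<Longrightarrow> mat_mono A B l m N \<Longrightarrow> mat_mono A B l m (\<lambda>i j. M i j - N i j)"
  by (fastforce simp: mat_mono_def)

lemma mat_mono_scale: "mat_mono A B l m M \<Longrightarrow> mat_mono A B l m (\<lambda>i j. c * M i j)"
  by (fastforce simp: mat_mono_def)

lemma mat_mono_id: "mat_mono A A l l id_mat"
  by (simp add: mat_mono_def id_mat_def)

lemma mat_mono_zero: "mat_mono A B l m (\<lambda>i j. 0)"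
  by (simp add: mat_mono_def)

text \<open>
  For every \<open>x\<close> the generators with label \<open>\<ge> x\<close> span a subcomplex of a complex of free abelian
  groups; these subcomplexes form a projective resolution of the contravariant functor that is
  \<open>\<int>\<close> at \<open>t\<close> and \<open>0\<close> elsewhere.
\<close>

locale labelled_resolution =
  fixes t :: "'a::order" and I :: "int \<Rightarrow> 'i set" and l :: "'i \<Rightarrow> 'a" and d :: "'i \<Rightarrow> 'i \<Rightarrow> int"
  assumes fin: "finite (I n)"
    and neg: "n < 0 \<Longrightarrow> I n = {}"
    and bottom_degree: "\<exists>s. I 0 = {s} \<and> l s = t"
    and label_neq: "n > 0 \<Longrightarrow> i \<in> I n \<Longrightarrow> l i \<noteq> t"
    and mono: "mat_mono (I n) (I (n - 1)) l l d"
    and dd: "i \<in> I n \<Longrightarrow> k \<in> I (n - 2) \<Longrightarrow> mat_prod (I (n - 1)) d d i k = 0"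
    and exact: "x \<noteq> t \<Longrightarrow> (\<And>i. w i \<noteq> 0 \<Longrightarrow> i \<in> I n \<and> x \<le> l i) \<Longrightarrow>
      (\<And>k. k \<in> I (n - 1) \<Longrightarrow> (\<Sum>i\<in>I n. w i * d i k) = 0) \<Longrightarrow>
      \<exists>u. (\<forall>j\<in>I (n + 1). u j \<noteq> 0 \<longrightarrow> x \<le> l j) \<and> (\<forall>i\<in>I n. (\<Sum>j\<in>I (n + 1). u j * d j i) = w i)"
begin

text \<open>Each row \<open>a\<close> by itself is an element supported on labels
  \<open>\<ge> m a\<close>, so \<open>exact\<close> solves one row at a time; the solutions are
  assembled into a matrix by choice.\<close>

lemma exact_rows:
  assumes W: "mat_mono A (I n) m l W"
    and A: "\<And>a. a \<in> A \<Longrightarrow> m a \<noteq> t"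
    and cycle: "\<And>a k. a \<in> A \<Longrightarrow> k \<in> I (n - 1) \<Longrightarrow> mat_prod (I n) W d a k = 0"
  shows "\<exists>U. mat_mono A (I (n + 1)) m l U \<and>
    (\<forall>a\<in>A. \<forall>i\<in>I n. mat_prod (I (n + 1)) U d a i = W a i)"
proof -
  have "\<exists>u. (\<forall>j\<in>I (n + 1). u j \<noteq> 0 \<longrightarrow> m a \<le> l j) \<and>
        (\<forall>i\<in>I n. (\<Sum>j\<in>I (n + 1). u j * d j i) = W a i)" if a: "a \<in> A" for a
  proof -
    \<comment> \<open>\<open>exact\<close> asks for support inside \<open>I n\<close>, while
      \<open>W\<close> is unconstrained outside it; hence the cutoff.\<close>
    define w where "w = (\<lambda>i. if i \<in> I n then W a i else 0)"
    have "\<exists>u. (\<forall>j\<in>I (n + 1). u j \<noteq> 0 \<longrightarrow> m a \<le> l j) \<and>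
        (\<forall>i\<in>I n. (\<Sum>j\<in>I (n + 1). u j * d j i) = w i)"
    proof (rule exact)
      show "m a \<noteq> t" using A a .
      show "i \<in> I n \<and> m a \<le> l i" if "w i \<noteq> 0" for i
        using that W a by (auto simp: w_def mat_mono_def split: if_splits)
      show "(\<Sum>i\<in>I n. w i * d i k) = 0" if "k \<in> I (n - 1)" for k
        using cycle [OF a that] by (simp add: mat_prod_def w_def)
    qed
    then show ?thesis by (simp add: w_def)
  qed
  then obtain U where "\<And>a. a \<in> A \<Longrightarrow> (\<forall>j\<in>I (n + 1). U a j \<noteq> 0 \<longrightarrow> m a \<le> l j) \<and>
        (\<forall>i\<in>I n. (\<Sum>j\<in>I (n + 1). U a j * d j i) = W a i)"
    by metis
  then show ?thesis
    by (intro exI [of _ U]) (auto simp: mat_mono_def mat_prod_def)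
qed

end

text \<open>
  With \<open>e = 0\<close> and \<open>r = 0\<close> this constructs chain maps, with \<open>e = 1\<close> it constructs chain
  homotopies.
\<close>

lemma comparison_extension:
  fixes t :: "'a::order" and I :: "int \<Rightarrow> 'i set" and J :: "int \<Rightarrow> 'j set"
    and r :: "int \<Rightarrow> 'i \<Rightarrow> 'j \<Rightarrow> int"
  assumes I: "labelled_resolution t I l d" and J: "labelled_resolution t J m b"
    and r_mono: "\<And>n. mat_mono (I n) (J (n + e - 1)) l m (r n)"
    and r_cycle: "\<And>n i k. i \<in> I n \<Longrightarrow> k \<in> J (n + e - 2) \<Longrightarrow>
      mat_prod (J (n + e - 1)) (r n) b i k + mat_prod (I (n - 1)) d (r (n - 1)) i k = 0"
    and X0_mono: "mat_mono (I 0) (J e) l m X0"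
    and X0: "\<And>i k. i \<in> I 0 \<Longrightarrow> k \<in> J (e - 1) \<Longrightarrow> mat_prod (J e) X0 b i k = r 0 i k"
  shows "\<exists>X. X 0 = X0 \<and> (\<forall>n. mat_mono (I n) (J (n + e)) l m (X n)) \<and>
    (\<forall>n. \<forall>i\<in>I n. \<forall>k\<in>J (n + e - 1).
       mat_prod (J (n + e)) (X n) b i k = r n i k + mat_prod (I (n - 1)) d (X (n - 1)) i k)"
proof -
  interpret I: labelled_resolution t I l d by (rule I)
  interpret J: labelled_resolution t J m b by (rule J)
  \<comment> \<open>\<open>W n Y\<close> is the matrix to be lifted in degree \<open>n\<close> once
    \<open>Y\<close> solves degree \<open>n - 1\<close>.\<close>
  define W where "W = (\<lambda>n Y i j. r n i j + mat_prod (I (n - 1)) d Y i j)"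
  \<comment> \<open>\<open>P\<close> also records that the next matrix to be lifted consists of
    cycles, as \<open>exact_rows\<close> demands. This depends on the chosen \<open>Y\<close>, so it
    has to be carried through the recursion.\<close>
  define P where "P = (\<lambda>(n::nat) Y. (n = 0 \<longrightarrow> Y = X0) \<and> mat_mono (I (int n)) (J (int n + e)) l m Y \<and>
     (\<forall>i\<in>I (int n + 1). \<forall>k\<in>J (int n + e - 1). mat_prod (J (int n + e)) (W (int n + 1) Y) b i k = 0))"
  define Q where "Q = (\<lambda>(n::nat) Y Z. \<forall>i\<in>I (int n + 1). \<forall>k\<in>J (int n + e).
      mat_prod (J (int n + 1 + e)) Z b i k = W (int n + 1) Y i k)"
  have "\<exists>X. \<forall>n. P n (X n) \<and> Q n (X n) (X (Suc n))"
  proof (rule dependent_nat_choice)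
    have "mat_prod (J e) (W 1 X0) b i k = 0" if "i \<in> I 1" "k \<in> J (e - 1)" for i k
    proof -
      have "mat_prod (J e) (mat_prod (I 0) d X0) b i k = mat_prod (I 0) d (r 0) i k"
        unfolding mat_prod_assoc by (rule mat_prod_cong) (use X0 that in auto)
      then show ?thesis
        using r_cycle [of i 1 k] that by (simp add: W_def mat_prod_add_left algebra_simps)
    qed
    then show "\<exists>Y. P 0 Y"
      using X0_mono by (intro exI [of _ X0]) (auto simp: P_def)
  next
    fix Y and n :: nat
    assume Y: "P n Y"
    have "\<exists>U. mat_mono (I (int n + 1)) (J (int n + e + 1)) l m U \<and>
      (\<forall>a\<in>I (int n + 1). \<forall>i\<in>J (int n + e). mat_prod (J (int n + e + 1)) U b a i = W (int n + 1) Y a i)"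
    proof (rule J.exact_rows)
      show "mat_mono (I (int n + 1)) (J (int n + e)) l m (W (int n + 1) Y)"
        unfolding W_def
      proof (rule mat_mono_add)
        show "mat_mono (I (int n + 1)) (J (int n + e)) l m (r (int n + 1))"
          using r_mono [of "int n + 1"] by (simp add: add_ac)
        show "mat_mono (I (int n + 1)) (J (int n + e)) l m (mat_prod (I (int n + 1 - 1)) d Y)"
          using I.mono [of "int n + 1"] Y by (intro mat_mono_prod) (auto simp: P_def)
      qed
      show "l a \<noteq> t" if "a \<in> I (int n + 1)" for a
        using I.label_neq [OF _ that] by simp
      show "mat_prod (J (int n + e)) (W (int n + 1) Y) b a k = 0"
        if "a \<in> I (int n + 1)" "k \<in> J (int n + e - 1)" for a k
        using Y that by (simp add: P_def)
    qed
    then obtain Z where Z_mono: "mat_mono (I (int n + 1)) (J (int n + e + 1)) l m Z"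
      and Z: "\<And>a i. a \<in> I (int n + 1) \<Longrightarrow> i \<in> J (int n + e) \<Longrightarrow>
        mat_prod (J (int n + e + 1)) Z b a i = W (int n + 1) Y a i"
      by auto
    have eq: "int (Suc n) + e = int n + e + 1" "int (Suc n) = int n + 1" "int n + 1 + e = int n + e + 1"
      by auto
    \<comment> \<open>The obstruction in the next degree: inserting the equation solved by
      \<open>Z\<close> leaves \<open>r b + d r\<close>, zero by \<open>r_cycle\<close>, and a term
      \<open>d d Y\<close>, zero by \<open>dd\<close>.\<close>
    have "mat_prod (J (int n + e + 1)) (W (int n + 2) Z) b i k = 0"
      if i: "i \<in> I (int n + 2)" and k: "k \<in> J (int n + e)" for i k
    proof -
      have "mat_prod (J (int n + e + 1)) (mat_prod (I (int n + 1)) d Z) b i k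
          = mat_prod (I (int n + 1)) d (W (int n + 1) Y) i k"
        unfolding mat_prod_assoc by (rule mat_prod_cong) (use Z k in auto)
      also have "\<dots> = mat_prod (I (int n + 1)) d (r (int n + 1)) i k
          + mat_prod (I (int n)) (mat_prod (I (int n + 1)) d d) Y i k"
        unfolding W_def mat_prod_assoc by (simp add: mat_prod_add_right)
      also have "mat_prod (I (int n)) (mat_prod (I (int n + 1)) d d) Y i k
          = mat_prod (I (int n)) (\<lambda>i k. 0) Y i k"
        by (rule mat_prod_cong) (use I.dd [of i "int n + 2"] i in \<open>auto simp: algebra_simps\<close>)
      finally show ?thesis
        using r_cycle [of i "int n + 2" k] i k
        by (simp add: W_def mat_prod_add_left algebra_simps)
    qed
    then show "\<exists>Z. P (Suc n) Z \<and> Q n Y Z"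
      using Z_mono Z by (intro exI [of _ Z]) (auto simp: P_def Q_def eq add_ac)
  qed
  then obtain X where X: "\<And>n. P n (X n)" "\<And>n. Q n (X n) (X (Suc n))" by blast
  show ?thesis
  \<comment> \<open>In negative degrees \<open>nat\<close> repeats \<open>X 0\<close>, which is
    harmless because \<open>I n\<close> is empty there.\<close>
  proof (intro exI [of _ "\<lambda>n. X (nat n)"] conjI allI ballI)
    show "X (nat 0) = X0" using X(1) [of 0] by (simp add: P_def)
    show "mat_mono (I n) (J (n + e)) l m (X (nat n))" for n
      using X(1) [of "nat n"] I.neg [of n] by (cases "n < 0") (auto simp: P_def mat_mono_def)
    show "mat_prod (J (n + e)) (X (nat n)) b i k
        = r n i k + mat_prod (I (n - 1)) d (X (nat (n - 1))) i k"
      if "i \<in> I n" "k \<in> J (n + e - 1)" for n i k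
    proof -
      consider "n = 0" | N where "n = int N + 1"
        using I.neg [of n] \<open>i \<in> I n\<close> by (metis empty_iff not_less zero_le_imp_eq_int not0_implies_Suc of_nat_0 of_nat_Suc add.commute)
      then show ?thesis
      proof cases
        case 1
        \<comment> \<open>The sum over \<open>I (- 1)\<close> is empty, so the equation reduces to
          the hypothesis on \<open>X0\<close>.\<close>
        then show ?thesis
          using X(1) [of 0] X0 [of i k] that I.neg [of "-1"] by (simp add: P_def)
      next
        case 2
        then have [simp]: "nat (1 + int N) = Suc N" "nat n = Suc N" "nat (n - 1) = N" "n - 1 = int N" by auto
        show ?thesis
          using X(2) [of N] that 2 by (simp add: Q_def W_def algebra_simps)
      qed
    qed
  qed
qed

section \<open>Chain maps and homotopies between labelled resolutions\<close>

definition chain_matrix ::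
    "(int \<Rightarrow> 'i set) \<Rightarrow> ('i \<Rightarrow> 'a::order) \<Rightarrow> ('i \<Rightarrow> 'i \<Rightarrow> int) \<Rightarrow>
     (int \<Rightarrow> 'j set) \<Rightarrow> ('j \<Rightarrow> 'a) \<Rightarrow> ('j \<Rightarrow> 'j \<Rightarrow> int) \<Rightarrow> (int \<Rightarrow> 'i \<Rightarrow> 'j \<Rightarrow> int) \<Rightarrow> bool" where
  "chain_matrix I l d J m b X \<longleftrightarrow> (\<forall>n. mat_mono (I n) (J n) l m (X n)) \<and>
     (\<forall>n. \<forall>i\<in>I n. \<forall>k\<in>J (n - 1).
        mat_prod (J n) (X n) b i k = mat_prod (I (n - 1)) d (X (n - 1)) i k)"

lemma chain_matrix_id:
  assumes "\<And>n. finite (I n)"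
  shows "chain_matrix I l d I l d (\<lambda>n. id_mat)"
  using assms by (simp add: chain_matrix_def mat_mono_id mat_prod_id_left mat_prod_id_right)

lemma chain_matrix_prod:
  assumes X: "chain_matrix I l d J m b X" and Y: "chain_matrix J m b K q c Y"
  shows "chain_matrix I l d K q c (\<lambda>n. mat_prod (J n) (X n) (Y n))"
  unfolding chain_matrix_def
proof (intro conjI allI ballI)
  show "mat_mono (I n) (K n) l q (mat_prod (J n) (X n) (Y n))" for n
    using X Y by (auto simp: chain_matrix_def intro: mat_mono_prod)
  fix n i k assume ik: "i \<in> I n" "k \<in> K (n - 1)"
  have "mat_prod (K n) (mat_prod (J n) (X n) (Y n)) c i k
      = mat_prod (J n) (X n) (mat_prod (J (n - 1)) b (Y (n - 1))) i k"
    unfolding mat_prod_assoc by (rule mat_prod_cong) (use Y ik in \<open>auto simp: chain_matrix_def\<close>)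
  also have "\<dots> = mat_prod (J (n - 1)) (mat_prod (I (n - 1)) d (X (n - 1))) (Y (n - 1)) i k"
    unfolding mat_prod_assoc [symmetric]
    by (rule mat_prod_cong) (use X ik in \<open>auto simp: chain_matrix_def\<close>)
  finally show "mat_prod (K n) (mat_prod (J n) (X n) (Y n)) c i k
      = mat_prod (I (n - 1)) d (mat_prod (J (n - 1)) (X (n - 1)) (Y (n - 1))) i k"
    by (simp add: mat_prod_assoc)
qed

text \<open>For \<open>e = 0\<close> the equation on \<open>X0\<close> concerns
  \<open>J (- 1)\<close>, which is empty, so a monotone matrix is all it takes to start the
  recursion. The start \<open>1\<close> makes the composite of two such maps the identity in degree
  \<open>0\<close>.\<close>

lemma comparison_exists:
  assumes I: "labelled_resolution t I l d" and J: "labelled_resolution t J m b"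
  shows "\<exists>X. X 0 = (\<lambda>i j. 1) \<and> chain_matrix I l d J m b X"
proof -
  interpret I: labelled_resolution t I l d by (rule I)
  interpret J: labelled_resolution t J m b by (rule J)
  have "mat_mono (I 0) (J 0) l m (\<lambda>i j. 1)"
    using I.bottom_degree J.bottom_degree by (auto simp: mat_mono_def)
  then show ?thesis
    using comparison_extension [OF I J, of 0 "\<lambda>n i j. 0" "\<lambda>i j. 1"]
    by (auto simp: chain_matrix_def mat_mono_zero J.neg)
qed

lemma comparison_homotopic:
  assumes I: "labelled_resolution t I l d" and J: "labelled_resolution t J m b"
    and f: "chain_matrix I l d J m b f" and g: "chain_matrix I l d J m b g"
    and fg: "\<And>i j. i \<in> I 0 \<Longrightarrow> j \<in> J 0 \<Longrightarrow> f 0 i j = g 0 i j"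
  shows "\<exists>H. (\<forall>n. mat_mono (I n) (J (n + 1)) l m (H n)) \<and>
    (\<forall>n. \<forall>i\<in>I n. \<forall>k\<in>J n. f n i k = g n i k + mat_prod (J (n + 1)) (H n) b i k
       + mat_prod (I (n - 1)) d (H (n - 1)) i k)"
proof -
  interpret J: labelled_resolution t J m b by (rule J)
  \<comment> \<open>\<open>comparison_extension\<close> solves \<open>X b = r + d X\<close>, whereas
    a homotopy satisfies \<open>H b = (f - g) - d H\<close>. Alternating signs convert one into the
    other: \<open>r n\<close> is \<open>s n\<close> times \<open>f n - g n\<close>, and
    \<open>H n\<close> is \<open>s n\<close> times \<open>X n\<close>.\<close>
  define s :: "int \<Rightarrow> int" where "s n = (if even n then 1 else -1)" for n
  have s: "s n * s n = 1" "s (n - 1) = - s n" for n by (auto simp: s_def)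
  define r where "r n i j = s n * (f n i j - g n i j)" for n i j
  have rb: "mat_prod A (r n) b i k = s n * (mat_prod A (f n) b i k - mat_prod A (g n) b i k)"
    for A n i k unfolding r_def mat_prod_scale_left mat_prod_diff_left ..
  have dr: "mat_prod A d (r n) i k = s n * (mat_prod A d (f n) i k - mat_prod A d (g n) i k)"
    for A n i k unfolding r_def mat_prod_scale_right mat_prod_diff_right ..
  have "\<exists>X. X 0 = (\<lambda>i j. 0) \<and> (\<forall>n. mat_mono (I n) (J (n + 1)) l m (X n)) \<and>
    (\<forall>n. \<forall>i\<in>I n. \<forall>k\<in>J (n + 1 - 1).
       mat_prod (J (n + 1)) (X n) b i k = r n i k + mat_prod (I (n - 1)) d (X (n - 1)) i k)"
  proof (rule comparison_extension [OF I J])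
    show "mat_mono (I n) (J (n + 1 - 1)) l m (r n)" for n
      using f g unfolding r_def
      by (auto simp: chain_matrix_def intro!: mat_mono_scale mat_mono_diff)
    show "mat_prod (J (n + 1 - 1)) (r n) b i k + mat_prod (I (n - 1)) d (r (n - 1)) i k = 0"
      if "i \<in> I n" "k \<in> J (n + 1 - 2)" for n i k
      using f g that unfolding rb dr s by (simp add: chain_matrix_def)
    \<comment> \<open>Since \<open>f\<close> and \<open>g\<close> agree in degree \<open>0\<close>,
      the homotopy can start with \<open>0\<close>.\<close>
    show "mat_prod (J 1) (\<lambda>i j. 0) b i k = r 0 i k" if "i \<in> I 0" "k \<in> J (1 - 1)" for i k
      using fg that by (simp add: r_def)
  qed (rule mat_mono_zero)
  then obtain X where "\<forall>n. mat_mono (I n) (J (n + 1)) l m (X n)"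
    "\<forall>n. \<forall>i\<in>I n. \<forall>k\<in>J (n + 1 - 1).
       mat_prod (J (n + 1)) (X n) b i k = r n i k + mat_prod (I (n - 1)) d (X (n - 1)) i k"
    by blast
  then have X: "\<And>n. mat_mono (I n) (J (n + 1)) l m (X n)"
    "\<And>n i k. i \<in> I n \<Longrightarrow> k \<in> J n \<Longrightarrow>
       mat_prod (J (n + 1)) (X n) b i k = r n i k + mat_prod (I (n - 1)) d (X (n - 1)) i k"
    by auto
  show ?thesis
  proof (intro exI [of _ "\<lambda>n i j. s n * X n i j"] conjI allI ballI)
    show "mat_mono (I n) (J (n + 1)) l m (\<lambda>i j. s n * X n i j)" for n
      by (rule mat_mono_scale) (rule X(1))
    fix n i k assume "i \<in> I n" "k \<in> J n"
    then show "f n i k = g n i k + mat_prod (J (n + 1)) (\<lambda>i j. s n * X n i j) b i k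
       + mat_prod (I (n - 1)) d (\<lambda>i j. s (n - 1) * X (n - 1) i j) i k"
      unfolding mat_prod_scale_left mat_prod_scale_right s(2)
      using s(1) [of n] by (simp add: X(2) r_def distrib_left flip: mult.assoc)
  qed
qed

section \<open>Transporting coefficients along labels\<close>

lemma (in comm_monoid) finprod_swap:
  assumes "finite A" "finite B" "\<And>a b. a \<in> A \<Longrightarrow> b \<in> B \<Longrightarrow> h a b \<in> carrier G"
  shows "finprod G (\<lambda>a. finprod G (\<lambda>b. h a b) B) A = finprod G (\<lambda>b. finprod G (\<lambda>a. h a b) A) B"
  using assms(1,3)
proof (induction A)
  case empty
  then show ?case by simp
next
  case (insert a A)
  have "finprod G (\<lambda>b. finprod G (\<lambda>a. h a b) (insert a A)) B
      = finprod G (\<lambda>b. h a b \<otimes> finprod G (\<lambda>a. h a b) A) B"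
    using insert by (intro finprod_cong') (auto intro!: finprod_closed m_closed)
  also have "\<dots> = finprod G (\<lambda>b. h a b) B \<otimes> finprod G (\<lambda>b. finprod G (\<lambda>a. h a b) A) B"
    using insert by (intro finprod_multf) (auto intro!: finprod_closed)
  finally show ?case
    using insert by (subst finprod_insert) (auto intro!: finprod_closed)
qed

lemma hom_finprod:
  assumes "comm_group G" "comm_group H" "h \<in> hom G H" "finite A" "a \<in> A \<rightarrow> carrier G"
  shows "h (finprod G a A) = finprod H (\<lambda>i. h (a i)) A"
  using assms(4,5)
proof (induction A)
  case empty
  then show ?case
    using assms by (simp add: comm_group_def comm_monoid.finprod_empty hom_one)
next
  case (insert i A)
  interpret G: comm_group G by (rule assms)
  interpret H: comm_group H by (rule assms)
  have "h (finprod G a (insert i A)) = h (a i) \<otimes>\<^bsub>H\<^esub> h (finprod G a A)"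
    using insert assms G.finprod_closed [of a A]
    by (subst G.finprod_insert) (auto simp: hom_mult [OF assms(3)])
  also have "\<dots> = finprod H (\<lambda>i. h (a i)) (insert i A)"
    using insert assms by (subst H.finprod_insert) (auto simp: hom_def Pi_def)
  finally show ?case .
qed

lemma carrier_sum_group_finite:
  assumes "finite A" "\<And>i. i \<in> A \<Longrightarrow> group (G i)"
  shows "carrier (sum_group A G) = (\<Pi>\<^sub>E i\<in>A. carrier (G i))"
  using assms by (simp add: carrier_sum_group)

lemma comm_group_sum_group:
  assumes "\<And>i. i \<in> A \<Longrightarrow> comm_group (G i)"
  shows "comm_group (sum_group A G)"
proof -
  have gr: "group (G i)" if "i \<in> A" for i
    using assms that by (simp add: comm_group_def)
  then show ?thesis
    using assms
    by (intro group.group_comm_groupI)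
      (auto simp: carrier_sum_group PiE_iff intro!: restrict_ext comm_monoid.m_comm comm_group.axioms(1))
qed

locale ab_diagram =
  fixes F :: "'a::order \<Rightarrow> 'b monoid" and f :: "'a \<Rightarrow> 'a \<Rightarrow> 'b \<Rightarrow> 'b"
  assumes ab_functor: "ab_functor UNIV F f"
begin

lemma comm_group_F [simp]: "comm_group (F x)"
  using ab_functor unfolding ab_functor_def by auto

lemma group_F [simp]: "group (F x)"
  by (simp add: comm_group.axioms)

lemma hom_f: "x \<le> y \<Longrightarrow> f x y \<in> hom (F x) (F y)"
  using ab_functor unfolding ab_functor_def by auto

lemma f_closed: "x \<le> y \<Longrightarrow> g \<in> carrier (F x) \<Longrightarrow> f x y g \<in> carrier (F y)"
  using hom_f [of x y] by (auto simp: hom_def)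

lemma f_id: "g \<in> carrier (F x) \<Longrightarrow> f x x g = g"
  using ab_functor unfolding ab_functor_def by auto

lemma f_comp: "x \<le> y \<Longrightarrow> y \<le> z \<Longrightarrow> g \<in> carrier (F x) \<Longrightarrow> f y z (f x y g) = f x z g"
  using ab_functor unfolding ab_functor_def by (metis UNIV_I)

text \<open>Without \<open>x \<le> y\<close> there is no morphism to apply; the neutral element as
  default makes \<open>act x y k\<close> a homomorphism for all \<open>x\<close> and
  \<open>y\<close>. Thus every matrix acts by homomorphisms, and monotonicity enters only when two
  matrices are composed.\<close>

definition act :: "'a \<Rightarrow> 'a \<Rightarrow> int \<Rightarrow> 'b \<Rightarrow> 'b" where
  "act x y k g = (if x \<le> y then f x y g [^]\<^bsub>F y\<^esub> k else \<one>\<^bsub>F y\<^esub>)"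

lemma act_closed: "g \<in> carrier (F x) \<Longrightarrow> act x y k g \<in> carrier (F y)"
  by (simp add: act_def f_closed group.int_pow_closed group.is_monoid monoid.one_closed)

lemma act_0 [simp]: "act x y 0 g = \<one>\<^bsub>F y\<^esub>"
  by (simp add: act_def)

lemma act_id: "g \<in> carrier (F x) \<Longrightarrow> act x x 1 g = g"
  by (simp add: act_def f_id group.int_pow_1)

lemma act_hom: "act x y k \<in> hom (F x) (F y)"
proof (rule homI)
  show "act x y k g \<in> carrier (F y)" if "g \<in> carrier (F x)" for g
    using that by (rule act_closed)
  show "act x y k (g \<otimes>\<^bsub>F x\<^esub> h) = act x y k g \<otimes>\<^bsub>F y\<^esub> act x y k h"
    if "g \<in> carrier (F x)" "h \<in> carrier (F x)" for g h
    using that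
    by (simp add: act_def hom_mult [OF hom_f] comm_group.int_pow_distrib f_closed
        group.is_monoid monoid.one_closed monoid.l_one)
qed

lemma act_add:
  "g \<in> carrier (F x) \<Longrightarrow> act x y (k + k') g = act x y k g \<otimes>\<^bsub>F y\<^esub> act x y k' g"
  by (simp add: act_def group.int_pow_mult f_closed group.is_monoid monoid.one_closed monoid.l_one)

lemma act_sum:
  assumes "finite A" "g \<in> carrier (F x)"
  shows "act x y (\<Sum>a\<in>A. k a) g = finprod (F y) (\<lambda>a. act x y (k a) g) A"
  using assms
proof (induction A)
  case empty
  interpret comm_group "F y" by simp
  show ?case by simp
next
  case (insert a A)
  interpret comm_group "F y" by simp
  show ?case using insert by (subst finprod_insert) (auto simp: act_closed act_add)
qed

lemma act_one [simp]: "act x y k \<one>\<^bsub>F x\<^esub> = \<one>\<^bsub>F y\<^esub>"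
  using act_hom by (rule hom_one) simp_all

text \<open>If \<open>k\<close> or \<open>k'\<close> is zero, both sides are neutral. Otherwise the
  order hypotheses are essential: with \<open>x \<le> z\<close> but not \<open>x \<le> y\<close>,
  the left side would collapse to the default while the right side need not.\<close>

lemma act_act:
  assumes g: "g \<in> carrier (F x)" and "k \<noteq> 0 \<Longrightarrow> x \<le> y" "k' \<noteq> 0 \<Longrightarrow> y \<le> z"
  shows "act y z k' (act x y k g) = act x z (k * k') g"
proof (cases "k = 0 \<or> k' = 0")
  case True
  then show ?thesis by auto
next
  case False
  then have le: "x \<le> y" "y \<le> z" "x \<le> z" using assms order_trans by auto
  then show ?thesis
    using g by (simp add: act_def hom_int_pow [OF hom_f] f_closed f_comp group.int_pow_pow mult.commute)
qed

text \<open>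
  A label-monotone matrix is a natural transformation between sums of representable functors;
  \<open>realize\<close> is its tensor product with \<open>F\<close>.
\<close>

definition realize ::
    "('i \<Rightarrow> 'a) \<Rightarrow> ('j \<Rightarrow> 'a) \<Rightarrow> 'i set \<Rightarrow> 'j set \<Rightarrow> ('i \<Rightarrow> 'j \<Rightarrow> int) \<Rightarrow> ('i \<Rightarrow> 'b) \<Rightarrow> 'j \<Rightarrow> 'b" where
  "realize l m A B M c = (\<lambda>j\<in>B. finprod (F (m j)) (\<lambda>i. act (l i) (m j) (M i j) (c i)) A)"

abbreviation dsum :: "('i \<Rightarrow> 'a) \<Rightarrow> 'i set \<Rightarrow> ('i \<Rightarrow> 'b) monoid" where
  "dsum l A \<equiv> sum_group A (\<lambda>i. F (l i))"

lemma comm_group_dsum: "comm_group (dsum l A)"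
  by (rule comm_group_sum_group) simp

lemma carrier_dsum: "finite A \<Longrightarrow> carrier (dsum l A) = (\<Pi>\<^sub>E i\<in>A. carrier (F (l i)))"
  by (rule carrier_sum_group_finite) auto

lemma realize_closed:
  assumes "finite A" "finite B" "c \<in> carrier (dsum l A)"
  shows "realize l m A B M c \<in> carrier (dsum m B)"
proof -
  have "finprod (F (m j)) (\<lambda>i. act (l i) (m j) (M i j) (c i)) A \<in> carrier (F (m j))" for j
  proof -
    interpret comm_group "F (m j)" by simp
    show ?thesis using assms by (intro finprod_closed) (auto simp: carrier_dsum intro!: act_closed)
  qed
  then show ?thesis using assms by (auto simp: carrier_dsum realize_def)
qed

lemma realize_cong:
  assumes "\<And>i j. i \<in> A \<Longrightarrow> j \<in> B \<Longrightarrow> M i j = N i j" "finite A" "c \<in> carrier (dsum l A)"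
  shows "realize l m A B M c = realize l m A B N c"
  unfolding realize_def
proof (rule restrict_ext)
  fix j assume j: "j \<in> B"
  interpret comm_group "F (m j)" by simp
  show "finprod (F (m j)) (\<lambda>i. act (l i) (m j) (M i j) (c i)) A
      = finprod (F (m j)) (\<lambda>i. act (l i) (m j) (N i j) (c i)) A"
    using assms j by (intro finprod_cong') (auto simp: carrier_dsum intro!: act_closed)
qed

lemma realize_hom:
  assumes fin: "finite A" "finite B"
  shows "realize l m A B M \<in> hom (dsum l A) (dsum m B)"
proof (rule homI)
  show "realize l m A B M c \<in> carrier (dsum m B)" if "c \<in> carrier (dsum l A)" for c
    using fin that by (rule realize_closed)
  show "realize l m A B M (c \<otimes>\<^bsub>dsum l A\<^esub> c')
      = realize l m A B M c \<otimes>\<^bsub>dsum m B\<^esub> realize l m A B M c'"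
    if c: "c \<in> carrier (dsum l A)" "c' \<in> carrier (dsum l A)" for c c'
    unfolding realize_def mult_sum_group
  proof (rule restrict_ext)
    fix j assume j: "j \<in> B"
    interpret comm_group "F (m j)" by simp
    have "finprod (F (m j)) (\<lambda>i. act (l i) (m j) (M i j) ((\<lambda>i\<in>A. c i \<otimes>\<^bsub>F (l i)\<^esub> c' i) i)) A
      = finprod (F (m j)) (\<lambda>i. act (l i) (m j) (M i j) (c i) \<otimes>\<^bsub>F (m j)\<^esub>
          act (l i) (m j) (M i j) (c' i)) A"
      using c fin by (intro finprod_cong')
        (auto simp: carrier_dsum PiE_iff intro!: act_closed hom_mult [OF act_hom])
    also have "\<dots> = finprod (F (m j)) (\<lambda>i. act (l i) (m j) (M i j) (c i)) A \<otimes>\<^bsub>F (m j)\<^esub>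
        finprod (F (m j)) (\<lambda>i. act (l i) (m j) (M i j) (c' i)) A"
      using c fin by (intro finprod_multf) (auto simp: carrier_dsum intro!: act_closed)
    finally show "finprod (F (m j)) (\<lambda>i. act (l i) (m j) (M i j) ((\<lambda>i\<in>A. c i \<otimes>\<^bsub>F (l i)\<^esub> c' i) i)) A
      = (\<lambda>j\<in>B. finprod (F (m j)) (\<lambda>i. act (l i) (m j) (M i j) (c i)) A) j \<otimes>\<^bsub>F (m j)\<^esub>
        (\<lambda>j\<in>B. finprod (F (m j)) (\<lambda>i. act (l i) (m j) (M i j) (c' i)) A) j"
      using j by simp
  qed
qed

lemma realize_add:
  assumes "finite A" "c \<in> carrier (dsum l A)"
  shows "realize l m A B (\<lambda>i j. M i j + N i j) c
    = realize l m A B M c \<otimes>\<^bsub>dsum m B\<^esub> realize l m A B N c"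
  unfolding realize_def mult_sum_group
proof (rule restrict_ext)
  fix j assume j: "j \<in> B"
  interpret comm_group "F (m j)" by simp
  have "finprod (F (m j)) (\<lambda>i. act (l i) (m j) (M i j + N i j) (c i)) A
    = finprod (F (m j)) (\<lambda>i. act (l i) (m j) (M i j) (c i) \<otimes>\<^bsub>F (m j)\<^esub> act (l i) (m j) (N i j) (c i)) A"
    using assms by (intro finprod_cong') (auto simp: carrier_dsum PiE_iff act_add intro!: act_closed)
  also have "\<dots> = finprod (F (m j)) (\<lambda>i. act (l i) (m j) (M i j) (c i)) A \<otimes>\<^bsub>F (m j)\<^esub>
        finprod (F (m j)) (\<lambda>i. act (l i) (m j) (N i j) (c i)) A"
    using assms by (intro finprod_multf) (auto simp: carrier_dsum intro!: act_closed)
  finally show "finprod (F (m j)) (\<lambda>i. act (l i) (m j) (M i j + N i j) (c i)) A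
      = (\<lambda>j\<in>B. finprod (F (m j)) (\<lambda>i. act (l i) (m j) (M i j) (c i)) A) j \<otimes>\<^bsub>F (m j)\<^esub>
        (\<lambda>j\<in>B. finprod (F (m j)) (\<lambda>i. act (l i) (m j) (N i j) (c i)) A) j"
    using j by simp
qed

lemma realize_zero: "realize l m A B (\<lambda>i j. 0) c = \<one>\<^bsub>dsum m B\<^esub>"
  unfolding realize_def one_sum_group
proof (rule restrict_ext)
  fix j
  interpret comm_group "F (m j)" by simp
  show "finprod (F (m j)) (\<lambda>i. act (l i) (m j) 0 (c i)) A = \<one>\<^bsub>F (m j)\<^esub>" by simp
qed

lemma realize_id:
  assumes "finite A" "c \<in> carrier (dsum l A)"
  shows "realize l l A A id_mat c = c"
proof
  fix j
  interpret comm_group "F (l j)" by simp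
  show "realize l l A A id_mat c j = c j"
  proof (cases "j \<in> A")
    case True
    have "finprod (F (l j)) (\<lambda>i. act (l i) (l j) (id_mat i j) (c i)) A
        = finprod (F (l j)) (\<lambda>i. if j = i then c i else \<one>\<^bsub>F (l j)\<^esub>) A"
      using assms by (intro finprod_cong') (auto simp: carrier_dsum id_mat_def PiE_iff act_id)
    also have "\<dots> = finprod (F (l j)) (\<lambda>i. if j = i then c j else \<one>\<^bsub>F (l j)\<^esub>) A"
      using assms True by (intro finprod_cong') (auto simp: carrier_dsum PiE_iff)
    also have "\<dots> = c j"
      using assms True by (intro finprod_singleton) (auto simp: carrier_dsum PiE_iff)
    finally show ?thesis using True by (simp add: realize_def)
  next
    case False
    then show ?thesis using assms by (auto simp: realize_def carrier_dsum PiE_iff extensional_def)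
  qed
qed

text \<open>Functoriality, through which every identity between matrices passes to \<open>F\<close>.
  After the two finite products are interchanged, the factors for fixed \<open>i\<close> and
  \<open>k\<close> are multiples of one and the same element, which \<open>act_sum\<close> collects
  into the entry of the matrix product.\<close>

lemma realize_comp:
  assumes fin: "finite A" "finite B" and c: "c \<in> carrier (dsum l A)"
    and M: "mat_mono A B l m M" and N: "mat_mono B C m q N"
  shows "realize m q B C N (realize l m A B M c) = realize l q A C (mat_prod B M N) c"
  unfolding realize_def [of m q] realize_def [of l q]
proof (rule restrict_ext)
  fix k assume k: "k \<in> C"
  interpret comm_group "F (q k)" by simp
  have cl: "c i \<in> carrier (F (l i))" if "i \<in> A" for i
    using c fin that by (auto simp: carrier_dsum)
  have "finprod (F (q k)) (\<lambda>j. act (m j) (q k) (N j k) (realize l m A B M c j)) B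
      = finprod (F (q k)) (\<lambda>j. finprod (F (q k)) (\<lambda>i. act (l i) (q k) (M i j * N j k) (c i)) A) B"
  proof (rule finprod_cong')
    fix j assume j: "j \<in> B"
    have "act (m j) (q k) (N j k) (finprod (F (m j)) (\<lambda>i. act (l i) (m j) (M i j) (c i)) A)
        = finprod (F (q k)) (\<lambda>i. act (m j) (q k) (N j k) (act (l i) (m j) (M i j) (c i))) A"
      using fin cl by (intro hom_finprod) (auto intro!: act_hom act_closed)
    also have "\<dots> = finprod (F (q k)) (\<lambda>i. act (l i) (q k) (M i j * N j k) (c i)) A"
      using cl k j M N
      by (intro finprod_cong') (auto intro!: act_closed act_act mat_monoD [OF M] mat_monoD [OF N])
    finally show "act (m j) (q k) (N j k) (realize l m A B M c j)
        = finprod (F (q k)) (\<lambda>i. act (l i) (q k) (M i j * N j k) (c i)) A"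
      using j by (simp add: realize_def)
  qed (use cl in \<open>auto intro!: finprod_closed act_closed\<close>)
  also have "\<dots> = finprod (F (q k)) (\<lambda>i. finprod (F (q k)) (\<lambda>j. act (l i) (q k) (M i j * N j k) (c i)) B) A"
    using fin cl by (intro finprod_swap) (auto intro!: act_closed)
  also have "\<dots> = finprod (F (q k)) (\<lambda>i. act (l i) (q k) (mat_prod B M N i k) (c i)) A"
    unfolding mat_prod_def using fin cl
    by (intro finprod_cong') (auto intro!: act_closed simp: act_sum)
  finally show "finprod (F (q k)) (\<lambda>j. act (m j) (q k) (N j k) (realize l m A B M c j)) B
      = finprod (F (q k)) (\<lambda>i. act (l i) (q k) (mat_prod B M N i k) (c i)) A" .
qed

end

section \<open>Homology isomorphisms\<close>

locale chain_complex =
  fixes C :: "int \<Rightarrow> 'c monoid" and d :: "int \<Rightarrow> 'c \<Rightarrow> 'c"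
  assumes comm_group_C: "comm_group (C n)"
    and hom_d: "d n \<in> hom (C n) (C (n - 1))"
    and dd: "x \<in> carrier (C (n + 1)) \<Longrightarrow> d n (d (n + 1) x) = \<one>\<^bsub>C (n - 1)\<^esub>"
begin

lemma group_C: "group (C n)"
  using comm_group_C by (rule comm_group.axioms)

lemma d_closed: "x \<in> carrier (C n) \<Longrightarrow> d n x \<in> carrier (C (n - 1))"
  using hom_d by (auto simp: hom_def)

lemma hom_d': "d (n + 1) \<in> hom (C (n + 1)) (C n)"
  using hom_d [of "n + 1"] by simp

abbreviation cycles :: "int \<Rightarrow> 'c set" where
  "cycles n \<equiv> kernel (C n) (C (n - 1)) (d n)"

abbreviation boundaries :: "int \<Rightarrow> 'c set" where
  "boundaries n \<equiv> d (n + 1) ` carrier (C (n + 1))"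

abbreviation cycle_group :: "int \<Rightarrow> 'c monoid" where
  "cycle_group n \<equiv> (C n)\<lparr>carrier := cycles n\<rparr>"

lemma subgroup_cycles: "subgroup (cycles n) (C n)"
  using group_C hom_d by (intro group_hom.subgroup_kernel) (simp add: group_hom_def group_hom_axioms_def)

lemma subgroup_boundaries: "subgroup (boundaries n) (C n)"
  using group_C hom_d' by (intro group_hom.img_is_subgroup) (simp add: group_hom_def group_hom_axioms_def)

lemma boundaries_subset: "boundaries n \<subseteq> cycles n"
  using hom_d' [of n] dd by (auto simp: kernel_def hom_def)

lemma comm_group_cycle_group: "comm_group (cycle_group n)"
proof (rule group.group_comm_groupI)
  show "group (cycle_group n)"
    using subgroup_cycles group_C by (rule subgroup.subgroup_is_group)
  show "x \<otimes>\<^bsub>cycle_group n\<^esub> y = y \<otimes>\<^bsub>cycle_group n\<^esub> x"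
    if "x \<in> carrier (cycle_group n)" "y \<in> carrier (cycle_group n)" for x y
    using that comm_group_C by (auto simp: kernel_def comm_group_def intro: comm_monoid.m_comm)
qed

lemma normal_boundaries: "boundaries n \<lhd> cycle_group n"
proof -
  have "subgroup (boundaries n) (cycle_group n)"
    using subgroup_cycles subgroup_boundaries boundaries_subset
    by (intro group.subgroup_incl [OF group_C])
  then show ?thesis
    by (simp add: comm_group.normal_iff_subgroup [OF comm_group_cycle_group])
qed

lemma homology_eq: "homology C d n = cycle_group n Mod boundaries n"
  by (simp add: homology_def)

lemma group_homology: "group (homology C d n)"
  unfolding homology_eq using normal_boundaries by (rule normal.factorgroup_is_group)

end

text \<open>Sending a cycle \<open>z\<close> to the class of \<open>h z\<close> is a homomorphism;
  \<open>surj\<close> makes it onto, \<open>boundary\<close> and \<open>inj\<close> identify its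
  kernel with the boundaries, and the first isomorphism theorem concludes. The criterion is phrased
  with elements so as to serve both homotopy equivalences and quotient complexes.\<close>

lemma homology_isoI:
  fixes C :: "int \<Rightarrow> 'c monoid" and K :: "int \<Rightarrow> 'k monoid"
  assumes C: "chain_complex C d" and K: "chain_complex K b"
    and h: "h \<in> hom (C n) (K n)"
    and cycle: "\<And>z. z \<in> carrier (C n) \<Longrightarrow> d n z = \<one>\<^bsub>C (n - 1)\<^esub> \<Longrightarrow> b n (h z) = \<one>\<^bsub>K (n - 1)\<^esub>"
    and boundary: "\<And>c. c \<in> carrier (C (n + 1)) \<Longrightarrow> \<exists>w\<in>carrier (K (n + 1)). h (d (n + 1) c) = b (n + 1) w"
    and surj: "\<And>z. z \<in> carrier (K n) \<Longrightarrow> b n z = \<one>\<^bsub>K (n - 1)\<^esub> \<Longrightarrow>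
      \<exists>y\<in>carrier (C n). d n y = \<one>\<^bsub>C (n - 1)\<^esub> \<and>
        (\<exists>w\<in>carrier (K (n + 1)). h y = b (n + 1) w \<otimes>\<^bsub>K n\<^esub> z)"
    and inj: "\<And>z w. z \<in> carrier (C n) \<Longrightarrow> d n z = \<one>\<^bsub>C (n - 1)\<^esub> \<Longrightarrow> w \<in> carrier (K (n + 1)) \<Longrightarrow>
      h z = b (n + 1) w \<Longrightarrow> \<exists>c\<in>carrier (C (n + 1)). z = d (n + 1) c"
  shows "homology C d n \<cong> homology K b n"
proof -
  interpret C: chain_complex C d by (rule C)
  interpret K: chain_complex K b by (rule K)
  interpret N: normal "K.boundaries n" "K.cycle_group n" by (rule K.normal_boundaries)
  define q where "q = (\<lambda>z. K.boundaries n #>\<^bsub>K.cycle_group n\<^esub> h z)"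
  have h_cycles: "h z \<in> K.cycles n" if "z \<in> C.cycles n" for z
    using that h cycle by (auto simp: kernel_def hom_def)
  have "h \<in> hom (C.cycle_group n) (K.cycle_group n)"
    using h h_cycles by (auto simp: hom_def kernel_def)
  then have "(\<lambda>a. K.boundaries n #>\<^bsub>K.cycle_group n\<^esub> a) \<circ> h
      \<in> hom (C.cycle_group n) (K.cycle_group n Mod K.boundaries n)"
    using N.r_coset_hom_Mod by (rule hom_compose)
  then have q: "q \<in> hom (C.cycle_group n) (homology K b n)"
    by (simp add: q_def o_def K.homology_eq)
  interpret q: group_hom "C.cycle_group n" "homology K b n" q
    using q K.group_homology comm_group.axioms(2) [OF C.comm_group_cycle_group]
    by (simp add: group_hom_def group_hom_axioms_def)
  have "q ` carrier (C.cycle_group n) = carrier (homology K b n)"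
  proof (rule antisym)
    show "q ` carrier (C.cycle_group n) \<subseteq> carrier (homology K b n)"
      using q.hom_closed by auto
    show "carrier (homology K b n) \<subseteq> q ` carrier (C.cycle_group n)"
    proof
      fix S assume "S \<in> carrier (homology K b n)"
      then obtain z where z: "z \<in> K.cycles n" and S: "S = K.boundaries n #>\<^bsub>K.cycle_group n\<^esub> z"
        by (auto simp: K.homology_eq carrier_FactGroup)
      then obtain y w where y: "y \<in> C.cycles n" and w: "w \<in> carrier (K (n + 1))"
        and hy: "h y = b (n + 1) w \<otimes>\<^bsub>K n\<^esub> z"
        using surj [of z] by (auto simp: kernel_def)
      have "h y \<in> K.boundaries n #>\<^bsub>K.cycle_group n\<^esub> z"
        using hy w by (auto simp: r_coset_def)
      then have "S = q y"
        unfolding S q_def using z N.subgroup_axioms by (intro N.repr_independence) auto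
      then show "S \<in> q ` carrier (C.cycle_group n)" using y by auto
    qed
  qed
  then have "C.cycle_group n Mod kernel (C.cycle_group n) (homology K b n) q \<cong> homology K b n"
    by (rule q.FactGroup_iso)
  moreover have "kernel (C.cycle_group n) (homology K b n) q = C.boundaries n"
  proof -
    have "q z = \<one>\<^bsub>homology K b n\<^esub> \<longleftrightarrow> z \<in> C.boundaries n" if z: "z \<in> C.cycles n" for z
    proof -
      have "q z = \<one>\<^bsub>homology K b n\<^esub> \<longleftrightarrow> h z \<in> K.boundaries n"
        unfolding q_def K.homology_eq one_FactGroup
        using N.coset_join1 [of "K.boundaries n" "h z"] N.coset_join2 [of "h z" "K.boundaries n"]
          h_cycles [OF z] N.subgroup_axioms N.subset by auto
      also have "\<dots> \<longleftrightarrow> z \<in> C.boundaries n"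
        using inj [of z] boundary z by (auto simp: kernel_def)
      finally show ?thesis .
    qed
    then show ?thesis
      using C.boundaries_subset [of n] by (auto simp: kernel_def)
  qed
  ultimately show ?thesis by (simp add: C.homology_eq)
qed

text \<open>On a cycle \<open>z\<close> the terms \<open>s (d z)\<close> and \<open>u (b z)\<close>
  are trivial, so both composites change cycles by boundaries only.\<close>

lemma homotopy_equivalence_homology_iso:
  fixes C :: "int \<Rightarrow> 'c monoid" and K :: "int \<Rightarrow> 'k monoid"
  assumes C: "chain_complex C d" and K: "chain_complex K b"
    and h: "\<And>n. h n \<in> hom (C n) (K n)" and g: "\<And>n. g n \<in> hom (K n) (C n)"
    and hd: "\<And>n x. x \<in> carrier (C n) \<Longrightarrow> h (n - 1) (d n x) = b n (h n x)"
    and gb: "\<And>n x. x \<in> carrier (K n) \<Longrightarrow> g (n - 1) (b n x) = d n (g n x)"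
    and s: "\<And>n. s n \<in> hom (C n) (C (n + 1))" and u: "\<And>n. u n \<in> hom (K n) (K (n + 1))"
    and gh: "\<And>n x. x \<in> carrier (C n) \<Longrightarrow>
      g n (h n x) = x \<otimes>\<^bsub>C n\<^esub> d (n + 1) (s n x) \<otimes>\<^bsub>C n\<^esub> s (n - 1) (d n x)"
    and hg: "\<And>n x. x \<in> carrier (K n) \<Longrightarrow>
      h n (g n x) = x \<otimes>\<^bsub>K n\<^esub> b (n + 1) (u n x) \<otimes>\<^bsub>K n\<^esub> u (n - 1) (b n x)"
  shows "homology C d n \<cong> homology K b n"
proof (rule homology_isoI [OF C K h])
  interpret C: chain_complex C d by (rule C)
  interpret K: chain_complex K b by (rule K)
  have one: "h n \<one>\<^bsub>C n\<^esub> = \<one>\<^bsub>K n\<^esub>" "g n \<one>\<^bsub>K n\<^esub> = \<one>\<^bsub>C n\<^esub>"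
      "s n \<one>\<^bsub>C n\<^esub> = \<one>\<^bsub>C (n + 1)\<^esub>" "u n \<one>\<^bsub>K n\<^esub> = \<one>\<^bsub>K (n + 1)\<^esub>" for n
    using hom_one [OF h] hom_one [OF g] hom_one [OF s] hom_one [OF u] C.group_C K.group_C by auto
  have sx: "s n x \<in> carrier (C (n + 1))" if "x \<in> carrier (C n)" for n x
    using s [of n] that by (auto simp: hom_def)
  have ux: "u n x \<in> carrier (K (n + 1))" if "x \<in> carrier (K n)" for n x
    using u [of n] that by (auto simp: hom_def)
  have hx: "h n x \<in> carrier (K n)" if "x \<in> carrier (C n)" for n x
    using h [of n] that by (auto simp: hom_def)
  have gx: "g n x \<in> carrier (C n)" if "x \<in> carrier (K n)" for n x
    using g [of n] that by (auto simp: hom_def)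
  interpret Cn: comm_group "C n" by (rule C.comm_group_C)
  interpret Kn: comm_group "K n" by (rule K.comm_group_C)
  show "b n (h n z) = \<one>\<^bsub>K (n - 1)\<^esub>" if "z \<in> carrier (C n)" "d n z = \<one>\<^bsub>C (n - 1)\<^esub>" for z
    using hd [OF that(1)] that one by simp
  show "\<exists>w\<in>carrier (K (n + 1)). h n (d (n + 1) c) = b (n + 1) w" if "c \<in> carrier (C (n + 1))" for c
    using hd [OF that] hx [OF that] by auto
  show "\<exists>y\<in>carrier (C n). d n y = \<one>\<^bsub>C (n - 1)\<^esub> \<and>
        (\<exists>w\<in>carrier (K (n + 1)). h n y = b (n + 1) w \<otimes>\<^bsub>K n\<^esub> z)"
    if z: "z \<in> carrier (K n)" "b n z = \<one>\<^bsub>K (n - 1)\<^esub>" for z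
  proof (intro bexI conjI)
    show "g n z \<in> carrier (C n)" "u n z \<in> carrier (K (n + 1))" using z gx ux by auto
    show "d n (g n z) = \<one>\<^bsub>C (n - 1)\<^esub>" using gb [OF z(1)] z one by simp
    have "b (n + 1) (u n z) \<in> carrier (K n)"
      using K.d_closed [OF ux [OF z(1)]] by simp
    then show "h n (g n z) = b (n + 1) (u n z) \<otimes>\<^bsub>K n\<^esub> z"
      using hg [OF z(1)] z one(4) [of "n - 1"] by (simp add: Kn.m_comm)
  qed
  show "\<exists>c\<in>carrier (C (n + 1)). z = d (n + 1) c"
    if z: "z \<in> carrier (C n)" "d n z = \<one>\<^bsub>C (n - 1)\<^esub>" and w: "w \<in> carrier (K (n + 1))"
      and hz: "h n z = b (n + 1) w" for z w
  proof
    interpret Cn1: comm_group "C (n + 1)" by (rule C.comm_group_C)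
    \<comment> \<open>Applying \<open>g\<close> to \<open>h z = b w\<close> gives
      \<open>d (g w) = g (h z) = z + d (s z)\<close>, additively written; so \<open>z\<close> is the
      boundary of \<open>g w - s z\<close>.\<close>
    let ?c = "g (n + 1) w" and ?e = "s n z"
    have c: "?c \<in> carrier (C (n + 1))" "?e \<in> carrier (C (n + 1))" using w gx sx z by auto
    then have dc: "d (n + 1) ?c \<in> carrier (C n)" "d (n + 1) ?e \<in> carrier (C n)"
      using C.d_closed [OF c(1)] C.d_closed [OF c(2)] by auto
    show "?c \<otimes>\<^bsub>C (n + 1)\<^esub> inv\<^bsub>C (n + 1)\<^esub> ?e \<in> carrier (C (n + 1))" using c by simp
    have "d (n + 1) ?c = z \<otimes>\<^bsub>C n\<^esub> d (n + 1) ?e"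
      using gh [OF z(1)] z one(3) [of "n - 1"] gb [OF w] hz dc by simp
    moreover have "d (n + 1) (?c \<otimes>\<^bsub>C (n + 1)\<^esub> inv\<^bsub>C (n + 1)\<^esub> ?e)
        = d (n + 1) ?c \<otimes>\<^bsub>C n\<^esub> inv\<^bsub>C n\<^esub> d (n + 1) ?e"
      using c hom_mult [OF C.hom_d'] group_hom.hom_inv [of "C (n + 1)" "C n" "d (n + 1)" ?e]
        C.group_C C.hom_d' by (simp add: group_hom_def group_hom_axioms_def)
    ultimately show "z = d (n + 1) (?c \<otimes>\<^bsub>C (n + 1)\<^esub> inv\<^bsub>C (n + 1)\<^esub> ?e)"
      using dc z by (simp add: Cn.m_assoc)
  qed
qed

text \<open>The subcomplex enters as the kernel of \<open>p\<close>. That the quotient differential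
  is well defined, additive and of square zero is pulled back from \<open>K\<close> along the
  injective map induced by \<open>p\<close>; of the differential on \<open>C\<close> it is only
  asked that it land in the right group and be compatible with \<open>p\<close>.\<close>

lemma quotient_homology_iso:
  fixes C :: "int \<Rightarrow> 'c monoid" and K :: "int \<Rightarrow> 'k monoid"
  assumes K: "chain_complex K b" and C: "\<And>n. comm_group (C n)"
    and d_closed: "\<And>n c. c \<in> carrier (C n) \<Longrightarrow> d n c \<in> carrier (C (n - 1))"
    and p: "\<And>n. p n \<in> hom (C n) (K n)"
    and p_surj: "\<And>n. p n ` carrier (C n) = carrier (K n)"
    and B: "\<And>n. B n = kernel (C n) (K n) (p n)"
    and pd: "\<And>n c. c \<in> carrier (C n) \<Longrightarrow> p (n - 1) (d n c) = b n (p n c)"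
  shows "homology (quotient_group C B) (quotient_diff C d B) n \<cong> homology K b n"
proof -
  let ?Q = "quotient_group C B" and ?q = "quotient_diff C d B"
  interpret K: chain_complex K b by (rule K)
  have C_group: "group (C n)" for n using C by (rule comm_group.axioms)
  have gh: "group_hom (C n) (K n) (p n)" for n
    using C_group K.group_C p by (simp add: group_hom_def group_hom_axioms_def)
  define h where "h = (\<lambda>n S. the_elem (p n ` S))"
  have h_iso: "h n \<in> iso (?Q n) (K n)" for n
    using group_hom.FactGroup_iso_set [OF gh p_surj] by (simp add: h_def quotient_group_def B)
  have B_subset: "B n \<subseteq> carrier (C n)" and B_subgroup: "subgroup (B n) (C n)" for n
    using group_hom.subgroup_kernel [OF gh] by (auto simp: B kernel_def)
  have Q_comm: "comm_group (?Q n)" for n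
    unfolding quotient_group_def by (rule comm_group.abelian_FactGroup [OF C B_subgroup])
  have Q_cases: "\<exists>c\<in>carrier (C n). S = B n #>\<^bsub>C n\<^esub> c" if "S \<in> carrier (?Q n)" for S n
    using that by (auto simp: quotient_group_def carrier_FactGroup)
  have coset_closed: "B n #>\<^bsub>C n\<^esub> c \<in> carrier (?Q n)" if "c \<in> carrier (C n)" for c n
    using that by (auto simp: quotient_group_def carrier_FactGroup)
  have p_coset: "p n x = p n c" if "x \<in> B n #>\<^bsub>C n\<^esub> c" "c \<in> carrier (C n)" for n x c
    using that hom_mult [OF p] K.group_C hom_in_carrier [OF p]
    by (auto simp: r_coset_def B kernel_def group.is_monoid monoid.l_one)
  have coset_mem: "c \<in> B n #>\<^bsub>C n\<^esub> c" if "c \<in> carrier (C n)" for n c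
    using group.rcos_self [OF C_group that B_subgroup] .
  have h_coset: "h n (B n #>\<^bsub>C n\<^esub> c) = p n c" if c: "c \<in> carrier (C n)" for n c
  proof -
    have "p n ` (B n #>\<^bsub>C n\<^esub> c) = {p n c}"
      using p_coset [OF _ c] coset_mem [OF c] by blast
    then show ?thesis by (simp add: h_def)
  qed
  \<comment> \<open>This is the injectivity of the induced map \<open>h\<close>, and it yields the
    independence of representatives in \<open>q_coset\<close>.\<close>
  have coset_eqI: "B n #>\<^bsub>C n\<^esub> c = B n #>\<^bsub>C n\<^esub> c'"
    if "c \<in> carrier (C n)" "c' \<in> carrier (C n)" "p n c = p n c'" for n c c'
    using h_coset that h_iso [of n] coset_closed by (auto simp: iso_def bij_betw_def inj_on_def)
  have q_coset: "?q n (B n #>\<^bsub>C n\<^esub> c) = B (n - 1) #>\<^bsub>C (n - 1)\<^esub> d n c"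
    if c: "c \<in> carrier (C n)" for n c
  proof -
    have "B (n - 1) #>\<^bsub>C (n - 1)\<^esub> d n x = B (n - 1) #>\<^bsub>C (n - 1)\<^esub> d n c"
      if x: "x \<in> B n #>\<^bsub>C n\<^esub> c" for x
    proof -
      have "x \<in> carrier (C n)"
        using x c B_subset [of n] group.is_monoid [OF C_group [of n]]
        by (auto simp: r_coset_def intro!: monoid.m_closed)
      then show ?thesis
        using p_coset [OF x c] c by (intro coset_eqI) (auto simp: pd d_closed)
    qed
    then have "(\<lambda>c. B (n - 1) #>\<^bsub>C (n - 1)\<^esub> d n c) ` (B n #>\<^bsub>C n\<^esub> c)
        = {B (n - 1) #>\<^bsub>C (n - 1)\<^esub> d n c}"
      using coset_mem [OF c] by blast
    then show ?thesis by (simp add: quotient_diff_def)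
  qed
  have q_closed: "?q n S \<in> carrier (?Q (n - 1))" if "S \<in> carrier (?Q n)" for n S
    using Q_cases [OF that] q_coset d_closed coset_closed by auto
  have hq: "h (n - 1) (?q n S) = b n (h n S)" if "S \<in> carrier (?Q n)" for n S
    using Q_cases [OF that] by (auto simp: q_coset h_coset d_closed pd)
  have h_hom: "h n \<in> hom (?Q n) (K n)" and h_inj: "inj_on (h n) (carrier (?Q n))"
    and h_surj: "h n ` carrier (?Q n) = carrier (K n)" for n
    using h_iso [of n] by (auto simp: iso_def bij_betw_def)
  have h_one: "h n \<one>\<^bsub>?Q n\<^esub> = \<one>\<^bsub>K n\<^esub>" for n
    using h_hom comm_group.axioms(2) [OF Q_comm] K.group_C by (rule hom_one)
  have h_closed: "h n S \<in> carrier (K n)" if "S \<in> carrier (?Q n)" for n S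
    using h_surj that by blast
  have Q_m_closed: "S \<otimes>\<^bsub>?Q n\<^esub> T \<in> carrier (?Q n)"
    if "S \<in> carrier (?Q n)" "T \<in> carrier (?Q n)" for S T n
    using that Q_comm by (simp add: comm_group_def comm_monoid_def monoid.m_closed)
  have Q_one_closed: "\<one>\<^bsub>?Q n\<^esub> \<in> carrier (?Q n)" for n
    using Q_comm by (simp add: comm_group_def comm_monoid_def monoid.one_closed)
  have Q: "chain_complex ?Q ?q"
  proof (rule chain_complex.intro)
    show "?q n \<in> hom (?Q n) (?Q (n - 1))" for n
    proof (rule homI)
      fix S T assume ST: "S \<in> carrier (?Q n)" "T \<in> carrier (?Q n)"
      \<comment> \<open>Both sides are compared after applying the injective \<open>h\<close>, where
        the claim becomes additivity of \<open>b\<close>.\<close>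
      show "?q n (S \<otimes>\<^bsub>?Q n\<^esub> T) = ?q n S \<otimes>\<^bsub>?Q (n - 1)\<^esub> ?q n T"
        using ST hom_mult [OF h_hom] hom_mult [OF K.hom_d]
        by (intro inj_onD [OF h_inj [of "n - 1"]]) (auto simp: hq q_closed h_closed Q_m_closed)
    qed (rule q_closed)
    show "?q n (?q (n + 1) S) = \<one>\<^bsub>?Q (n - 1)\<^esub>" if S: "S \<in> carrier (?Q (n + 1))" for S n
      using q_closed [OF S] hq [OF S] K.dd [OF h_closed [OF S]]
      by (intro inj_onD [OF h_inj [of "n - 1"]]) (auto simp: hq q_closed h_one Q_one_closed)
  qed (rule Q_comm)
  show ?thesis
  proof (rule homology_isoI [OF Q K h_hom])
    show "b n (h n z) = \<one>\<^bsub>K (n - 1)\<^esub>" if "z \<in> carrier (?Q n)" "?q n z = \<one>\<^bsub>?Q (n - 1)\<^esub>" for z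
      using hq [OF that(1)] that h_one by simp
    show "\<exists>w\<in>carrier (K (n + 1)). h n (?q (n + 1) c) = b (n + 1) w"
      if "c \<in> carrier (?Q (n + 1))" for c
      using hq [OF that] h_closed [OF that] by auto
    show "\<exists>y\<in>carrier (?Q n). ?q n y = \<one>\<^bsub>?Q (n - 1)\<^esub> \<and>
        (\<exists>w\<in>carrier (K (n + 1)). h n y = b (n + 1) w \<otimes>\<^bsub>K n\<^esub> z)"
      if z: "z \<in> carrier (K n)" "b n z = \<one>\<^bsub>K (n - 1)\<^esub>" for z
    proof -
      obtain y where y: "y \<in> carrier (?Q n)" "h n y = z" using h_surj [of n] z(1) by (metis imageE)
      have "?q n y = \<one>\<^bsub>?Q (n - 1)\<^esub>"
        using y z by (intro inj_onD [OF h_inj [of "n - 1"]]) (auto simp: hq q_closed h_one Q_one_closed)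
      moreover have "h n y = b (n + 1) \<one>\<^bsub>K (n + 1)\<^esub> \<otimes>\<^bsub>K n\<^esub> z"
        using y z hom_one [OF K.hom_d'] K.group_C
        by (simp add: group.is_monoid monoid.l_one)
      ultimately show ?thesis
        using y K.group_C group.is_monoid monoid.one_closed by blast
    qed
    show "\<exists>c\<in>carrier (?Q (n + 1)). z = ?q (n + 1) c"
      if z: "z \<in> carrier (?Q n)" and w: "w \<in> carrier (K (n + 1))" "h n z = b (n + 1) w" for z w
    proof -
      obtain c where c: "c \<in> carrier (?Q (n + 1))" "h (n + 1) c = w" using h_surj [of "n + 1"] w(1) by (metis imageE)
      have "z = ?q (n + 1) c"
        using z w c hq [OF c(1)] q_closed [OF c(1)] by (intro inj_onD [OF h_inj [of n]]) auto
      then show ?thesis using c by blast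
    qed
  qed
qed

section \<open>Homology of a labelled resolution with coefficients in \<open>F\<close>\<close>

context ab_diagram
begin

lemma resolution_chain_complex:
  assumes "labelled_resolution t I l d"
  shows "chain_complex (\<lambda>n. dsum l (I n)) (\<lambda>n. realize l l (I n) (I (n - 1)) d)"
proof -
  interpret I: labelled_resolution t I l d by (rule assms)
  show ?thesis
  proof (rule chain_complex.intro)
    show "comm_group (dsum l (I n))" for n by (rule comm_group_dsum)
    show "realize l l (I n) (I (n - 1)) d \<in> hom (dsum l (I n)) (dsum l (I (n - 1)))" for n
      by (intro realize_hom I.fin)
    fix c n assume c: "c \<in> carrier (dsum l (I (n + 1)))"
    have "realize l l (I n) (I (n - 1)) d (realize l l (I (n + 1)) (I n) d c)
        = realize l l (I (n + 1)) (I (n - 1)) (mat_prod (I n) d d) c"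
      using c I.mono [of n] I.mono [of "n + 1"] by (intro realize_comp I.fin) auto
    also have "\<dots> = realize l l (I (n + 1)) (I (n - 1)) (\<lambda>i j. 0) c"
      using c I.dd [of _ "n + 1"] by (intro realize_cong I.fin) auto
    finally show "realize l l (I n) (I (n - 1)) d (realize l l (I (n + 1)) (I (n + 1 - 1)) d c)
        = \<one>\<^bsub>dsum l (I (n - 1))\<^esub>"
      by (simp only: realize_zero add_diff_cancel_right')
  qed
qed

lemma realize_chain_matrix:
  assumes I: "labelled_resolution t I l d" and J: "labelled_resolution t J m b"
    and X: "chain_matrix I l d J m b X" and c: "c \<in> carrier (dsum l (I n))"
  shows "realize l m (I (n - 1)) (J (n - 1)) (X (n - 1)) (realize l l (I n) (I (n - 1)) d c)
    = realize m m (J n) (J (n - 1)) b (realize l m (I n) (J n) (X n) c)"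
proof -
  interpret I: labelled_resolution t I l d by (rule I)
  interpret J: labelled_resolution t J m b by (rule J)
  have mono: "mat_mono (I n) (J n) l m (X n)" for n using X by (simp add: chain_matrix_def)
  show ?thesis
    unfolding realize_comp [OF I.fin I.fin c I.mono mono] realize_comp [OF I.fin J.fin c mono J.mono]
    using X c by (intro realize_cong I.fin) (auto simp: chain_matrix_def)
qed

lemma realize_homotopy:
  assumes I: "labelled_resolution t I l d" and c: "c \<in> carrier (dsum l (I n))"
    and mono: "\<And>n. mat_mono (I n) (I (n + 1)) l l (H n)"
    and H: "\<And>i k. i \<in> I n \<Longrightarrow> k \<in> I n \<Longrightarrow> M i k = id_mat i k + mat_prod (I (n + 1)) (H n) d i k
       + mat_prod (I (n - 1)) d (H (n - 1)) i k"
  shows "realize l l (I n) (I n) M c =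
    c \<otimes>\<^bsub>dsum l (I n)\<^esub> realize l l (I (n + 1)) (I n) d (realize l l (I n) (I (n + 1)) (H n) c)
      \<otimes>\<^bsub>dsum l (I n)\<^esub> realize l l (I (n - 1)) (I n) (H (n - 1)) (realize l l (I n) (I (n - 1)) d c)"
proof -
  interpret I: labelled_resolution t I l d by (rule I)
  have d_mono: "mat_mono (I (n + 1)) (I n) l l d" and H_mono: "mat_mono (I (n - 1)) (I n) l l (H (n - 1))"
    using I.mono [of "n + 1"] mono [of "n - 1"] by auto
  have "realize l l (I n) (I n) M c = realize l l (I n) (I n)
      (\<lambda>i k. id_mat i k + mat_prod (I (n + 1)) (H n) d i k + mat_prod (I (n - 1)) d (H (n - 1)) i k) c"
    using H c by (intro realize_cong I.fin)
  then show ?thesis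
    by (simp only: realize_add [OF I.fin c] realize_id [OF I.fin c]
        realize_comp [OF I.fin I.fin c mono d_mono] realize_comp [OF I.fin I.fin c I.mono H_mono])
qed

theorem resolution_homology_iso:
  fixes I :: "int \<Rightarrow> 'i set" and J :: "int \<Rightarrow> 'j set"
  assumes I: "labelled_resolution t I l d" and J: "labelled_resolution t J m b"
  shows "homology (\<lambda>n. dsum l (I n)) (\<lambda>n. realize l l (I n) (I (n - 1)) d) n
    \<cong> homology (\<lambda>n. dsum m (J n)) (\<lambda>n. realize m m (J n) (J (n - 1)) b) n"
proof -
  interpret I: labelled_resolution t I l d by (rule I)
  interpret J: labelled_resolution t J m b by (rule J)
  obtain X where X0: "X 0 = (\<lambda>i j. 1)" and X: "chain_matrix I l d J m b X"
    using comparison_exists [OF I J] by blast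
  obtain Y where Y0: "Y 0 = (\<lambda>i j. 1)" and Y: "chain_matrix J m b I l d Y"
    using comparison_exists [OF J I] by blast
  have X_mono: "mat_mono (I n) (J n) l m (X n)" and Y_mono: "mat_mono (J n) (I n) m l (Y n)" for n
    using X Y by (auto simp: chain_matrix_def)
  \<comment> \<open>\<open>J 0\<close> has one element, so the product of the two constant
    \<open>1\<close> matrices is again \<open>1\<close>, the identity on the single generator in
    \<open>I 0\<close>. This agreement in degree \<open>0\<close> is what starts the
    homotopy.\<close>
  have "mat_prod (J 0) (X 0) (Y 0) i j = id_mat i j" if "i \<in> I 0" "j \<in> I 0" for i j
    using that I.bottom_degree J.bottom_degree by (auto simp: mat_prod_def X0 Y0 id_mat_def)
  then obtain H where H_mono: "\<And>n. mat_mono (I n) (I (n + 1)) l l (H n)"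
    and H: "\<And>n i k. i \<in> I n \<Longrightarrow> k \<in> I n \<Longrightarrow> mat_prod (J n) (X n) (Y n) i k =
      id_mat i k + mat_prod (I (n + 1)) (H n) d i k + mat_prod (I (n - 1)) d (H (n - 1)) i k"
    using comparison_homotopic [OF I I chain_matrix_prod [OF X Y] chain_matrix_id [OF I.fin]]
    by blast
  have "mat_prod (I 0) (Y 0) (X 0) i j = id_mat i j" if "i \<in> J 0" "j \<in> J 0" for i j
    using that I.bottom_degree J.bottom_degree by (auto simp: mat_prod_def X0 Y0 id_mat_def)
  then obtain G where G_mono: "\<And>n. mat_mono (J n) (J (n + 1)) m m (G n)"
    and G: "\<And>n i k. i \<in> J n \<Longrightarrow> k \<in> J n \<Longrightarrow> mat_prod (I n) (Y n) (X n) i k =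
      id_mat i k + mat_prod (J (n + 1)) (G n) b i k + mat_prod (J (n - 1)) b (G (n - 1)) i k"
    using comparison_homotopic [OF J J chain_matrix_prod [OF Y X] chain_matrix_id [OF J.fin]]
    by blast
  show ?thesis
  proof (rule homotopy_equivalence_homology_iso [OF resolution_chain_complex [OF I] resolution_chain_complex [OF J],
      where h = "\<lambda>n. realize l m (I n) (J n) (X n)" and g = "\<lambda>n. realize m l (J n) (I n) (Y n)"
        and s = "\<lambda>n. realize l l (I n) (I (n + 1)) (H n)" and u = "\<lambda>n. realize m m (J n) (J (n + 1)) (G n)"])
    show "realize m l (J n) (I n) (Y n) (realize l m (I n) (J n) (X n) c) =
      c \<otimes>\<^bsub>dsum l (I n)\<^esub> realize l l (I (n + 1)) (I (n + 1 - 1)) d (realize l l (I n) (I (n + 1)) (H n) c)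
      \<otimes>\<^bsub>dsum l (I n)\<^esub>
      realize l l (I (n - 1)) (I (n - 1 + 1)) (H (n - 1)) (realize l l (I n) (I (n - 1)) d c)"
      if "c \<in> carrier (dsum l (I n))" for n c
      using realize_comp [OF I.fin J.fin that X_mono Y_mono] realize_homotopy [OF I that H_mono H]
      by simp
    show "realize l m (I n) (J n) (X n) (realize m l (J n) (I n) (Y n) c) =
      c \<otimes>\<^bsub>dsum m (J n)\<^esub> realize m m (J (n + 1)) (J (n + 1 - 1)) b (realize m m (J n) (J (n + 1)) (G n) c)
      \<otimes>\<^bsub>dsum m (J n)\<^esub>
      realize m m (J (n - 1)) (J (n - 1 + 1)) (G (n - 1)) (realize m m (J n) (J (n - 1)) b c)"
      if "c \<in> carrier (dsum m (J n))" for n c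
      using realize_comp [OF J.fin I.fin that Y_mono X_mono] realize_homotopy [OF J that G_mono G]
      by simp
  qed (intro realize_hom I.fin J.fin realize_chain_matrix [OF I J X] realize_chain_matrix [OF J I Y]; assumption)+
qed

end

section \<open>Chains containing the top element\<close>

text \<open>Exchanging the two variables shows that the sum is its own negative. This is the
  cancellation behind \<open>d d = 0\<close> in both complexes, where \<open>y\<close> and
  \<open>z\<close> are the two vertices deleted or the two atoms added.\<close>

lemma sum_antisymmetric:
  fixes g :: "'i \<Rightarrow> 'i \<Rightarrow> int"
  assumes "finite A" and g: "\<And>y z. y \<in> A \<Longrightarrow> z \<in> A \<Longrightarrow> y \<noteq> z \<Longrightarrow> g y z = - g z y"
  shows "(\<Sum>y\<in>A. \<Sum>z\<in>A - {y}. g y z) = 0"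
proof -
  \<comment> \<open>Filling the diagonal with \<open>0\<close> makes the index set a full square, so
    that \<open>sum.swap\<close> applies.\<close>
  define h where "h y z = (if y = z then 0 else g y z)" for y z
  have "(\<Sum>y\<in>A. \<Sum>z\<in>A - {y}. g y z) = (\<Sum>y\<in>A. \<Sum>z\<in>A. h y z)"
    using assms(1) by (intro sum.cong sum.mono_neutral_cong_left) (auto simp: h_def)
  moreover have "(\<Sum>y\<in>A. \<Sum>z\<in>A. h y z) = - (\<Sum>y\<in>A. \<Sum>z\<in>A. h y z)"
  proof -
    have "(\<Sum>y\<in>A. \<Sum>z\<in>A. h y z) = (\<Sum>y\<in>A. \<Sum>z\<in>A. - h z y)"
    proof (intro sum.cong refl)
      show "h y z = - h z y" if "y \<in> A" "z \<in> A" for y z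
        using g [OF that] by (auto simp: h_def)
    qed
    also have "\<dots> = - (\<Sum>y\<in>A. \<Sum>z\<in>A. h z y)"
      by (simp only: sum_negf)
    also have "(\<Sum>y\<in>A. \<Sum>z\<in>A. h z y) = (\<Sum>y\<in>A. \<Sum>z\<in>A. h y z)"
      by (rule sum.swap)
    finally show ?thesis .
  qed
  ultimately show ?thesis by linarith
qed

section \<open>Positions and minima in finite chains\<close>

lemma chain_subset: "Complete_Partial_Order.chain (\<le>) \<tau> \<Longrightarrow> \<sigma> \<subseteq> \<tau> \<Longrightarrow> Complete_Partial_Order.chain (\<le>) \<sigma>"
  by (auto simp: chain_def)

lemma vertex_eqI:
  fixes \<sigma> :: "'a::order set"
  assumes chain: "Complete_Partial_Order.chain (\<le>) \<sigma>" and "finite \<sigma>"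
    and x: "x \<in> \<sigma>" and i: "card {y \<in> \<sigma>. y < x} = i"
  shows "vertex \<sigma> i = x"
  unfolding vertex_def
proof (rule the_equality)
  show "x \<in> \<sigma> \<and> card {y \<in> \<sigma>. y < x} = i" using x i by simp
  fix z assume z: "z \<in> \<sigma> \<and> card {y \<in> \<sigma>. y < z} = i"
  have less: "card {y \<in> \<sigma>. y < a} < card {y \<in> \<sigma>. y < b}" if "a \<in> \<sigma>" "a < b" for a b
    using that \<open>finite \<sigma>\<close> by (intro psubset_card_mono) (auto dest: less_trans)
  have "z \<le> x \<or> x \<le> z" using chain z x by (auto simp: chain_def)
  then show "z = x"
    using less [of z x] less [of x z] z i x by (auto simp: order.order_iff_strict)
qed

lemma vertex_0_eqI:
  fixes \<sigma> :: "'a::order set"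
  assumes "Complete_Partial_Order.chain (\<le>) \<sigma>" "finite \<sigma>" "x \<in> \<sigma>" "\<And>y. y \<in> \<sigma> \<Longrightarrow> x \<le> y"
  shows "vertex \<sigma> 0 = x"
proof (rule vertex_eqI [OF assms(1-3)])
  have "{y \<in> \<sigma>. y < x} = {}" using assms(4) by (auto dest: leD)
  then show "card {y \<in> \<sigma>. y < x} = 0" by (simp only: card.empty)
qed

lemma chain_has_least:
  fixes \<sigma> :: "'a::order set"
  assumes "finite \<sigma>" "\<sigma> \<noteq> {}" "Complete_Partial_Order.chain (\<le>) \<sigma>"
  shows "\<exists>x\<in>\<sigma>. \<forall>y\<in>\<sigma>. x \<le> y"
proof -
  obtain x where x: "x \<in> \<sigma>" "\<And>y. y \<in> \<sigma> \<Longrightarrow> \<not> y < x"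
    using ex_min_if_finite [OF assms(1,2)] by blast
  have "x \<le> y" if "y \<in> \<sigma>" for y
    using x(2) [OF that] x(1) that assms(3) by (auto simp: chain_def order.order_iff_strict)
  then show ?thesis using x(1) by blast
qed

lemma le_vertex_0_iff:
  fixes \<sigma> :: "'a::order set"
  assumes "finite \<sigma>" "\<sigma> \<noteq> {}" "Complete_Partial_Order.chain (\<le>) \<sigma>"
  shows "x \<le> vertex \<sigma> 0 \<longleftrightarrow> (\<forall>y\<in>\<sigma>. x \<le> y)"
proof -
  obtain z where z: "z \<in> \<sigma>" "\<And>y. y \<in> \<sigma> \<Longrightarrow> z \<le> y"
    using chain_has_least [OF assms] by blast
  then have "vertex \<sigma> 0 = z" using assms by (intro vertex_0_eqI)
  then show ?thesis using z by (auto dest: order_trans)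
qed

text \<open>For \<open>x = \<sigma>\<^sub>i\<close> in a chain this is the face sign
  \<open>(-1)^i\<close>. Indexing it by the vertex instead of the position keeps the name of a
  vertex stable when other vertices are deleted.\<close>

definition pos_sign :: "'a::order set \<Rightarrow> 'a \<Rightarrow> int" where
  "pos_sign \<sigma> x = (- 1) ^ card {y \<in> \<sigma>. y < x}"

lemma pos_sign_remove_less:
  assumes "finite \<sigma>" "y \<in> \<sigma>" "y < x"
  shows "pos_sign (\<sigma> - {y}) x = - pos_sign \<sigma> x"
proof -
  have "{z \<in> \<sigma>. z < x} = insert y {z \<in> \<sigma> - {y}. z < x}" using assms by auto
  then have "card {z \<in> \<sigma>. z < x} = Suc (card {z \<in> \<sigma> - {y}. z < x})"
    using assms by (subst \<open>_ = insert y _\<close>) (simp add: card_insert_disjoint)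
  then show ?thesis by (simp add: pos_sign_def)
qed

lemma pos_sign_remove_not_less:
  assumes "\<not> y < x"
  shows "pos_sign (\<sigma> - {y}) x = pos_sign \<sigma> x"
proof -
  have "{z \<in> \<sigma> - {y}. z < x} = {z \<in> \<sigma>. z < x}" using assms by auto
  then show ?thesis by (simp only: pos_sign_def)
qed

lemma pos_sign_least: "(\<And>y. y \<in> \<sigma> \<Longrightarrow> x \<le> y) \<Longrightarrow> pos_sign \<sigma> x = 1"
proof -
  assume "\<And>y. y \<in> \<sigma> \<Longrightarrow> x \<le> y"
  then have "{y \<in> \<sigma>. y < x} = {}" by (auto dest: leD)
  then show ?thesis by (simp only: pos_sign_def card.empty power_0)
qed

text \<open>Deleting the smaller vertex lowers the position of the larger one by one; deleting the
  larger vertex leaves the smaller one in place.\<close>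

lemma pos_sign_swap:
  fixes \<sigma> :: "'a::order set"
  assumes "finite \<sigma>" "Complete_Partial_Order.chain (\<le>) \<sigma>" "x \<in> \<sigma>" "y \<in> \<sigma>" "x \<noteq> y"
  shows "pos_sign \<sigma> x * pos_sign (\<sigma> - {x}) y = - (pos_sign \<sigma> y * pos_sign (\<sigma> - {y}) x)"
proof -
  have *: "pos_sign \<sigma> a * pos_sign (\<sigma> - {a}) b = - (pos_sign \<sigma> b * pos_sign (\<sigma> - {b}) a)"
    if "a \<in> \<sigma>" "a < b" for a b
    using that assms(1) pos_sign_remove_less [of \<sigma> a b] pos_sign_remove_not_less [of b a \<sigma>]
    by auto
  have "x < y \<or> y < x" using assms by (auto simp: chain_def order.order_iff_strict)
  then show ?thesis using * [of x y] * [of y x] assms by auto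
qed

definition top_chains :: "int \<Rightarrow> 'a::{finite, order_top} set set" where
  "top_chains n = {\<sigma> \<in> Ch UNIV n. Orderings.top \<in> \<sigma>}"

lemma top_chains_iff:
  "\<sigma> \<in> top_chains n \<longleftrightarrow>
    Complete_Partial_Order.chain (\<le>) \<sigma> \<and> Orderings.top \<in> \<sigma> \<and> int (card \<sigma>) = n + 1"
proof -
  have "card \<sigma> > 0" if "Orderings.top \<in> \<sigma>" using that by (auto simp: card_gt_0_iff)
  then show ?thesis by (auto simp: top_chains_def Ch_def)
qed

lemma top_chains_remove:
  assumes "\<sigma> \<in> top_chains n" "x \<in> \<sigma>" "x \<noteq> Orderings.top"
  shows "\<sigma> - {x} \<in> top_chains (n - 1)"
proof -
  have "card \<sigma> > 0" using assms by (auto simp: card_gt_0_iff)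
  then show ?thesis
    using assms by (auto simp: top_chains_iff card_Diff_singleton of_nat_diff intro: chain_subset)
qed

lemma top_chains_insert:
  assumes "\<sigma> \<in> top_chains n" "x \<notin> \<sigma>" "\<And>y. y \<in> \<sigma> \<Longrightarrow> x \<le> y"
  shows "insert x \<sigma> \<in> top_chains (n + 1)"
  using assms by (auto simp: top_chains_iff chain_def)

text \<open>The face omitting \<open>1\<close> is left out because it lies in the subcomplex of
  \<open>L - {1}\<close> and so vanishes in the quotient. For given \<open>\<sigma>\<close> and
  \<open>\<tau>\<close> at most one summand is nonzero; the form of a sum is chosen for
  interchanging summations and for \<open>act_sum\<close>.\<close>

definition incidence :: "'a::order_top set \<Rightarrow> 'a set \<Rightarrow> int" where
  "incidence \<tau> \<sigma> = (\<Sum>x\<in>\<tau> - {Orderings.top}. if \<sigma> = \<tau> - {x} then pos_sign \<tau> x else 0)"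

lemma sum_incidence:
  fixes \<tau> :: "'a::{finite, order_top} set"
  assumes "\<tau> \<in> top_chains n"
  shows "(\<Sum>\<sigma>\<in>top_chains (n - 1). incidence \<tau> \<sigma> * v \<sigma>)
    = (\<Sum>x\<in>\<tau> - {Orderings.top}. pos_sign \<tau> x * v (\<tau> - {x}))"
proof -
  have "(\<Sum>\<sigma>\<in>top_chains (n - 1). incidence \<tau> \<sigma> * v \<sigma>)
    = (\<Sum>\<sigma>\<in>top_chains (n - 1). \<Sum>x\<in>\<tau> - {Orderings.top}. if \<sigma> = \<tau> - {x} then pos_sign \<tau> x * v \<sigma> else 0)"
    unfolding incidence_def sum_distrib_right by (intro sum.cong refl) simp
  also have "\<dots> = (\<Sum>x\<in>\<tau> - {Orderings.top}. \<Sum>\<sigma>\<in>top_chains (n - 1). if \<sigma> = \<tau> - {x} then pos_sign \<tau> x * v \<sigma> else 0)"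
    by (rule sum.swap)
  also have "\<dots> = (\<Sum>x\<in>\<tau> - {Orderings.top}. pos_sign \<tau> x * v (\<tau> - {x}))"
    using assms by (intro sum.cong refl) (auto simp: sum.delta' top_chains_remove)
  finally show ?thesis .
qed

text \<open>A column of the matrix: the chains with face \<open>\<sigma>\<close> arise by inserting
  a vertex outside \<open>\<sigma>\<close>, which differs from \<open>1\<close> because
  \<open>1\<close> is already in \<open>\<sigma>\<close>.\<close>

lemma sum_incidence':
  fixes \<sigma> :: "'a::{finite, order_top} set"
  assumes "Orderings.top \<in> \<sigma>"
  shows "(\<Sum>\<tau>\<in>top_chains n. u \<tau> * incidence \<tau> \<sigma>)
    = (\<Sum>x\<in>- \<sigma>. if insert x \<sigma> \<in> top_chains n then u (insert x \<sigma>) * pos_sign (insert x \<sigma>) x else 0)"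
proof -
  have "(\<Sum>\<tau>\<in>top_chains n. u \<tau> * incidence \<tau> \<sigma>)
    = (\<Sum>\<tau>\<in>top_chains n. \<Sum>x\<in>- \<sigma>. if \<tau> = insert x \<sigma> then u \<tau> * pos_sign \<tau> x else 0)"
  proof (rule sum.cong)
    fix \<tau> :: "'a set" assume "\<tau> \<in> top_chains n"
    have "incidence \<tau> \<sigma> = (\<Sum>x\<in>- \<sigma>. if \<tau> = insert x \<sigma> then pos_sign \<tau> x else 0)"
      unfolding incidence_def
      by (rule sum.mono_neutral_cong) (use assms in auto)
    show "u \<tau> * incidence \<tau> \<sigma> = (\<Sum>x\<in>- \<sigma>. if \<tau> = insert x \<sigma> then u \<tau> * pos_sign \<tau> x else 0)"
      unfolding \<open>incidence \<tau> \<sigma> = _\<close> sum_distrib_left by (intro sum.cong refl) simp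
  qed simp
  also have "\<dots> = (\<Sum>x\<in>- \<sigma>. \<Sum>\<tau>\<in>top_chains n. if \<tau> = insert x \<sigma> then u \<tau> * pos_sign \<tau> x else 0)"
    by (rule sum.swap)
  also have "\<dots> = (\<Sum>x\<in>- \<sigma>. if insert x \<sigma> \<in> top_chains n then u (insert x \<sigma>) * pos_sign (insert x \<sigma>) x else 0)"
    by (intro sum.cong refl) (auto simp: sum.delta')
  finally show ?thesis .
qed

lemma incidence_nonzeroE:
  assumes "incidence \<tau> \<sigma> \<noteq> 0"
  obtains x where "x \<in> \<tau>" "x \<noteq> Orderings.top" "\<sigma> = \<tau> - {x}"
proof -
  obtain x where "x \<in> \<tau> - {Orderings.top}" "(if \<sigma> = \<tau> - {x} then pos_sign \<tau> x else 0) \<noteq> 0"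
    using assms unfolding incidence_def by (rule sum.not_neutral_contains_not_neutral)
  then show ?thesis by (intro that [of x]) (auto split: if_splits)
qed

lemma le_vertex_0_top_chain:
  fixes \<sigma> :: "'a::{finite, order_top} set"
  assumes "\<sigma> \<in> top_chains n"
  shows "x \<le> vertex \<sigma> 0 \<longleftrightarrow> (\<forall>y\<in>\<sigma>. x \<le> y)"
  using assms by (intro le_vertex_0_iff) (auto simp: top_chains_iff)

text \<open>The witness is the cone operator that adjoins \<open>x\<close> as new minimum. Its
  boundary is read off at \<open>\<sigma>\<close>: if \<open>x\<close> is not in
  \<open>\<sigma>\<close>, only the insertion of \<open>x\<close> contributes; if it is, the cycle
  condition at \<open>\<sigma> - {x}\<close> trades the coned terms for \<open>w \<sigma>\<close>.
  That face still contains \<open>1\<close> because \<open>x \<noteq> 1\<close>.\<close>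

lemma incidence_exact:
  fixes w :: "'a::{finite, order_top} set \<Rightarrow> int"
  assumes x: "x \<noteq> Orderings.top"
    and w: "\<And>\<sigma>. w \<sigma> \<noteq> 0 \<Longrightarrow> \<sigma> \<in> top_chains n \<and> (\<forall>y\<in>\<sigma>. x \<le> y)"
    and cycle: "\<And>\<rho>. \<rho> \<in> top_chains (n - 1) \<Longrightarrow> (\<Sum>\<sigma>\<in>top_chains n. w \<sigma> * incidence \<sigma> \<rho>) = 0"
    and \<sigma>: "\<sigma> \<in> top_chains n"
  shows "(\<Sum>\<tau>\<in>top_chains (n + 1). (if x \<in> \<tau> then w (\<tau> - {x}) else 0) * incidence \<tau> \<sigma>) = w \<sigma>"
    (is "?S = _")
proof -
  let ?t = "\<lambda>y. if insert y \<sigma> \<in> top_chains (n + 1) then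
      (if x \<in> insert y \<sigma> then w (insert y \<sigma> - {x}) else 0) * pos_sign (insert y \<sigma>) y else 0"
  have top: "Orderings.top \<in> \<sigma>" using \<sigma> by (simp add: top_chains_iff)
  have S: "?S = (\<Sum>y\<in>- \<sigma>. ?t y)" using top by (rule sum_incidence')
  show ?thesis
  proof (cases "x \<in> \<sigma>")
    case False
    have "(\<Sum>y\<in>- \<sigma>. ?t y) = (\<Sum>y\<in>{x}. ?t y)"
      using False by (intro sum.mono_neutral_right) auto
    also have "\<dots> = w \<sigma>"
    \<comment> \<open>If \<open>w \<sigma> = 0\<close>, both sides vanish whether or not
      \<open>insert x \<sigma>\<close> is a chain; otherwise the support of \<open>w\<close> puts
      \<open>x\<close> below all of \<open>\<sigma>\<close>.\<close>
    proof (cases "w \<sigma> = 0")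
      case True
      then show ?thesis using False by auto
    next
      case w0: False
      then have "insert x \<sigma> \<in> top_chains (n + 1)" "pos_sign (insert x \<sigma>) x = 1"
        using w [OF w0] False by (auto intro: top_chains_insert pos_sign_least)
      then show ?thesis using False by simp
    qed
    finally show ?thesis using S by simp
  next
    case True
    let ?r = "\<sigma> - {x}"
    have \<rho>: "?r \<in> top_chains (n - 1)" using \<sigma> True x by (rule top_chains_remove)
    \<comment> \<open>The insertion \<open>y = x\<close> returns \<open>\<sigma>\<close> itself; the
      remaining insertions will match \<open>?t\<close> up to sign.\<close>
    have "(\<Sum>y\<in>- ?r. if insert y ?r \<in> top_chains n then w (insert y ?r) * pos_sign (insert y ?r) y else 0) = 0"
      using cycle [OF \<rho>] sum_incidence' [of ?r w n] \<rho> by (simp add: top_chains_iff)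
    moreover have "- ?r = insert x (- \<sigma>)" using True by auto
    ultimately have "w \<sigma> * pos_sign \<sigma> x = - (\<Sum>y\<in>- \<sigma>.
        if insert y ?r \<in> top_chains n then w (insert y ?r) * pos_sign (insert y ?r) y else 0)"
      using True \<sigma> by (simp add: insert_absorb)
    also have "\<dots> = (\<Sum>y\<in>- \<sigma>. ?t y)"
      unfolding sum_negf [symmetric]
    proof (rule sum.cong)
      fix y assume y: "y \<in> - \<sigma>"
      have eq: "insert y \<sigma> - {x} = insert y ?r" using True y by auto
      show "- (if insert y ?r \<in> top_chains n then w (insert y ?r) * pos_sign (insert y ?r) y else 0) = ?t y"
      proof (cases "w (insert y ?r) = 0")
        case w0: True
        then show ?thesis using True eq by auto
      next
        case w0: False
        then have yr: "insert y ?r \<in> top_chains n" and le: "\<And>z. z \<in> insert y ?r \<Longrightarrow> x \<le> z"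
          using w by blast+
        \<comment> \<open>Deleting \<open>x\<close> therefore lowers the position of
          \<open>y\<close> by one, which supplies the minus sign.\<close>
        have "x < y" using le [of y] y True by (auto simp: order.order_iff_strict)
        have "insert x (insert y ?r) \<in> top_chains (n + 1)"
          using yr le y True by (intro top_chains_insert) auto
        moreover have "insert x (insert y ?r) = insert y \<sigma>" using True by auto
        moreover have "pos_sign (insert y ?r) y = - pos_sign (insert y \<sigma>) y"
          using pos_sign_remove_less [of "insert y \<sigma>" x y] \<open>x < y\<close> True eq by simp
        ultimately show ?thesis using True yr eq by simp
      qed
    qed simp
    also have "w \<sigma> * pos_sign \<sigma> x = w \<sigma>"
    proof (cases "w \<sigma> = 0")
      case w0: False
      then show ?thesis using w [OF w0] by (simp add: pos_sign_least)
    qed simp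
    finally show ?thesis using S by simp
  qed
qed

text \<open>Deleting a vertex can only raise the minimum, whence monotonicity; a chain with minimum
  \<open>1\<close> is just \<open>{1}\<close>, so this label occurs in degree \<open>0\<close>
  alone.\<close>

lemma top_chains_resolution:
  "labelled_resolution (Orderings.top :: 'a::{finite, order_top}) top_chains (\<lambda>\<sigma>. vertex \<sigma> 0) incidence"
proof
  show "finite (top_chains n :: 'a set set)" for n by simp
  show "(top_chains n :: 'a set set) = {}" if "n < 0" for n
    using that by (auto simp: top_chains_def Ch_def)
  have "\<sigma> = {Orderings.top}" if "\<sigma> \<in> top_chains 0" for \<sigma> :: "'a set"
    using that by (auto simp: top_chains_iff card_1_singleton_iff)
  moreover have "{Orderings.top :: 'a} \<in> top_chains 0"
    by (simp add: top_chains_iff chain_def)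
  ultimately have "(top_chains 0 :: 'a set set) = {{Orderings.top}}"
    by blast
  moreover have "vertex {Orderings.top :: 'a} 0 = Orderings.top"
    by (rule vertex_0_eqI) (auto simp: chain_def)
  ultimately show "\<exists>s. (top_chains 0 :: 'a set set) = {s} \<and> vertex s 0 = Orderings.top"
    by auto
  show "vertex \<sigma> 0 \<noteq> Orderings.top" if "n > 0" "\<sigma> \<in> top_chains n" for n and \<sigma> :: "'a set"
  proof
    assume "vertex \<sigma> 0 = Orderings.top"
    then have "\<sigma> = {Orderings.top}"
      using le_vertex_0_top_chain [OF that(2), of Orderings.top] that(2)
      by (auto simp: top_chains_iff top_unique)
    then show False using that by (auto simp: top_chains_iff)
  qed
  show "mat_mono (top_chains n) (top_chains (n - 1)) (\<lambda>\<sigma>. vertex \<sigma> 0) (\<lambda>\<sigma>. vertex \<sigma> 0)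
      (incidence :: 'a set \<Rightarrow> 'a set \<Rightarrow> int)" for n
    unfolding mat_mono_def
  proof (intro ballI impI)
    fix \<tau> \<sigma> :: "'a set"
    assume "\<tau> \<in> top_chains n" "\<sigma> \<in> top_chains (n - 1)" "incidence \<tau> \<sigma> \<noteq> 0"
    then show "vertex \<tau> 0 \<le> vertex \<sigma> 0"
      using le_vertex_0_top_chain [of \<tau> n "vertex \<tau> 0"]
      by (subst le_vertex_0_top_chain [of \<sigma> "n - 1"]) (auto elim: incidence_nonzeroE)
  qed
  show "mat_prod (top_chains (n - 1)) incidence incidence \<tau> \<rho> = 0"
    if \<tau>: "\<tau> \<in> top_chains n" and "\<rho> \<in> top_chains (n - 2)" for n and \<tau> \<rho> :: "'a set"
  proof -
    let ?A = "\<tau> - {Orderings.top}"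
    have chain: "Complete_Partial_Order.chain (\<le>) \<tau>" using \<tau> by (simp add: top_chains_iff)
    have "mat_prod (top_chains (n - 1)) incidence incidence \<tau> \<rho>
        = (\<Sum>x\<in>?A. pos_sign \<tau> x * incidence (\<tau> - {x}) \<rho>)"
      unfolding mat_prod_def using \<tau> by (rule sum_incidence)
    also have "\<dots> = (\<Sum>x\<in>?A. \<Sum>y\<in>?A - {x}. if \<rho> = \<tau> - {x} - {y} then pos_sign \<tau> x * pos_sign (\<tau> - {x}) y else 0)"
    proof (rule sum.cong)
      fix x
      have eq: "\<tau> - {x} - {Orderings.top} = ?A - {x}" by blast
      show "pos_sign \<tau> x * incidence (\<tau> - {x}) \<rho>
        = (\<Sum>y\<in>?A - {x}. if \<rho> = \<tau> - {x} - {y} then pos_sign \<tau> x * pos_sign (\<tau> - {x}) y else 0)"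
        unfolding incidence_def sum_distrib_left eq by (intro sum.cong refl) simp
    qed simp
    also have "\<dots> = 0"
    proof (rule sum_antisymmetric)
      fix x y assume "x \<in> ?A" "y \<in> ?A" "x \<noteq> y"
      moreover have "\<tau> - {x} - {y} = \<tau> - {y} - {x}" by blast
      ultimately show "(if \<rho> = \<tau> - {x} - {y} then pos_sign \<tau> x * pos_sign (\<tau> - {x}) y else 0)
          = - (if \<rho> = \<tau> - {y} - {x} then pos_sign \<tau> y * pos_sign (\<tau> - {y}) x else 0)"
        using pos_sign_swap [OF _ chain, of x y] by simp
    qed simp
    finally show ?thesis .
  qed
  fix x :: 'a and w :: "'a set \<Rightarrow> int" and n
  assume x: "x \<noteq> Orderings.top"
    and w: "\<And>\<sigma>. w \<sigma> \<noteq> 0 \<Longrightarrow> \<sigma> \<in> top_chains n \<and> x \<le> vertex \<sigma> 0"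
    and cycle: "\<And>\<rho>. \<rho> \<in> top_chains (n - 1) \<Longrightarrow> (\<Sum>\<sigma>\<in>top_chains n. w \<sigma> * incidence \<sigma> \<rho>) = 0"
  have w': "\<sigma> \<in> top_chains n \<and> (\<forall>y\<in>\<sigma>. x \<le> y)" if "w \<sigma> \<noteq> 0" for \<sigma>
    using w [OF that] le_vertex_0_top_chain by blast
  show "\<exists>u. (\<forall>\<tau>\<in>top_chains (n + 1). u \<tau> \<noteq> 0 \<longrightarrow> x \<le> vertex \<tau> 0) \<and>
      (\<forall>\<sigma>\<in>top_chains n. (\<Sum>\<tau>\<in>top_chains (n + 1). u \<tau> * incidence \<tau> \<sigma>) = w \<sigma>)"
  proof (intro exI conjI ballI impI)
    show "(\<Sum>\<tau>\<in>top_chains (n + 1). (if x \<in> \<tau> then w (\<tau> - {x}) else 0) * incidence \<tau> \<sigma>) = w \<sigma>"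
      if "\<sigma> \<in> top_chains n" for \<sigma>
      using x w' cycle that by (rule incidence_exact)
    fix \<tau> :: "'a set"
    assume \<tau>: "\<tau> \<in> top_chains (n + 1)" and "(if x \<in> \<tau> then w (\<tau> - {x}) else 0) \<noteq> 0"
    then have "\<forall>y\<in>\<tau> - {x}. x \<le> y" using w' by (auto split: if_splits)
    then show "x \<le> vertex \<tau> 0"
      unfolding le_vertex_0_top_chain [OF \<tau>] by auto
  qed
qed

section \<open>The cube complex\<close>

lemma finite_atoms [simp]: "finite (atoms :: 'a::{finite, order_bot} set)"
  by simp

lemma atom_le_iff_inf:
  fixes a :: "'a::boolean_algebra"
  assumes "a \<in> atoms"
  shows "\<not> a \<le> x \<longleftrightarrow> inf a x = bot"
proof
  assume "\<not> a \<le> x"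
  then have "inf a x < a" by (simp add: less_le_not_le)
  then show "inf a x = bot" using assms by (simp add: atoms_def)
next
  assume "inf a x = bot"
  then show "\<not> a \<le> x" using assms by (auto simp: atoms_def inf_absorb1)
qed

lemma atom_le_sup:
  fixes a :: "'a::boolean_algebra"
  assumes "a \<in> atoms"
  shows "a \<le> sup x y \<longleftrightarrow> a \<le> x \<or> a \<le> y"
proof
  assume le: "a \<le> sup x y"
  show "a \<le> x \<or> a \<le> y"
  proof (rule ccontr)
    assume "\<not> (a \<le> x \<or> a \<le> y)"
    then have "inf a (sup x y) = bot" using assms by (simp add: atom_le_iff_inf inf_sup_distrib1)
    then show False using le assms atom_le_iff_inf by blast
  qed
qed (auto intro: le_supI1 le_supI2)

lemma atom_le_atom: "a \<in> atoms \<Longrightarrow> b \<in> atoms \<Longrightarrow> a \<le> b \<longleftrightarrow> a = b"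
  by (auto simp: atoms_def order.order_iff_strict)

lemma atom_le_compl:
  fixes a :: "'a::boolean_algebra"
  assumes "a \<in> atoms"
  shows "a \<le> - x \<longleftrightarrow> \<not> a \<le> x"
  using atom_le_iff_inf [OF assms, of x] by (simp add: inf_shunt)

lemma atom_below:
  fixes x :: "'a::{finite, boolean_algebra}"
  assumes "x \<noteq> bot"
  shows "\<exists>a\<in>atoms. a \<le> x"
proof -
  obtain a where a: "a \<in> {y. y \<noteq> bot \<and> y \<le> x}" "\<And>y. y \<in> {y. y \<noteq> bot \<and> y \<le> x} \<Longrightarrow> \<not> y < a"
    using ex_min_if_finite [of "{y. y \<noteq> bot \<and> y \<le> x}"] assms by auto
  then have "a \<in> atoms" unfolding atoms_def using order_less_le_trans order_less_imp_le by blast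
  then show ?thesis using a(1) by auto
qed

lemma not_le_imp_atom:
  fixes x y :: "'a::{finite, boolean_algebra}"
  assumes "\<not> x \<le> y"
  shows "\<exists>a\<in>atoms. a \<le> x \<and> \<not> a \<le> y"
proof -
  have "inf x (- y) \<noteq> bot" using assms by (simp add: inf_shunt)
  then obtain a where "a \<in> atoms" "a \<le> inf x (- y)" using atom_below by blast
  then show ?thesis using atom_le_compl by auto
qed

lemma le_iff_atoms:
  fixes x y :: "'a::{finite, boolean_algebra}"
  shows "x \<le> y \<longleftrightarrow> (\<forall>a\<in>atoms. a \<le> x \<longrightarrow> a \<le> y)"
  using not_le_imp_atom [of x y] by (blast intro: order_trans)

text \<open>Lattice identities are reduced to atoms, on which joins and complements behave like
  unions and complements of sets.\<close>

lemma eq_iff_atoms: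
  fixes x y :: "'a::{finite, boolean_algebra}"
  shows "x = y \<longleftrightarrow> (\<forall>a\<in>atoms. a \<le> x \<longleftrightarrow> a \<le> y)"
  unfolding order.eq_iff [of x y] le_iff_atoms [of x y] le_iff_atoms [of y x] by blast

text \<open>Anything strictly above \<open>x\<close> and below \<open>sup x a\<close> gains some
  atom over \<open>x\<close>; that atom can only be \<open>a\<close>, so nothing lies strictly
  between.\<close>

lemma covered_by_iff:
  fixes x y :: "'a::{finite, boolean_algebra}"
  shows "covered_by x y \<longleftrightarrow> (\<exists>a\<in>atoms. \<not> a \<le> x \<and> y = sup x a)"
proof
  assume c: "covered_by x y"
  then have "\<not> y \<le> x" by (auto simp: covered_by_def)
  then obtain a where a: "a \<in> atoms" "a \<le> y" "\<not> a \<le> x" using not_le_imp_atom by blast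
  have "x < sup x a" using a by (simp add: less_le_not_le)
  moreover have "sup x a \<le> y" using a c by (auto simp: covered_by_def)
  ultimately have "y = sup x a" using c by (auto simp: covered_by_def order.order_iff_strict)
  then show "\<exists>a\<in>atoms. \<not> a \<le> x \<and> y = sup x a" using a by blast
next
  assume "\<exists>a\<in>atoms. \<not> a \<le> x \<and> y = sup x a"
  then obtain a where a: "a \<in> atoms" "\<not> a \<le> x" "y = sup x a" by blast
  have "z = y" if "x < z" "z \<le> y" for z
  proof -
    obtain b where b: "b \<in> atoms" "b \<le> z" "\<not> b \<le> x" using not_le_imp_atom [of z x] \<open>x < z\<close> by (auto simp: less_le_not_le)
    then have "b \<le> sup x a" using that a by auto
    then have "b = a" using a b by (simp add: atom_le_sup atom_le_atom)
    then show "z = y" using a b that by (simp add: order.antisym)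
  qed
  moreover have "x < y" using a by (simp add: less_le_not_le)
  ultimately show "covered_by x y" by (auto simp: covered_by_def order.strict_iff_order)
qed

lemma rk_sup_atom:
  fixes x a :: "'a::{finite, boolean_algebra}"
  assumes "a \<in> atoms" "\<not> a \<le> x"
  shows "rk (sup x a) = Suc (rk x)"
proof -
  have "{b \<in> atoms. b \<le> sup x a} = insert a {b \<in> atoms. b \<le> x}"
    using assms by (auto simp: atom_le_sup atom_le_atom)
  then show ?thesis using assms by (simp add: rk_def)
qed

lemma rk_less:
  fixes x y :: "'a::{finite, boolean_algebra}"
  assumes "x < y"
  shows "rk x < rk y"
proof -
  obtain a where "a \<in> atoms" "a \<le> y" "\<not> a \<le> x" using not_le_imp_atom [of y x] assms by (auto simp: less_le_not_le)
  then have "{b \<in> atoms. b \<le> x} \<subset> {b \<in> atoms. b \<le> y}" using assms by auto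
  then show ?thesis unfolding rk_def by (intro psubset_card_mono) auto
qed

lemma rk_top: "rk (Orderings.top :: 'a::{finite, boolean_algebra}) = card (atoms :: 'a set)"
  by (simp add: rk_def)

lemma D_neg:
  assumes "n < 0"
  shows "(D n :: 'a::{finite, boolean_algebra} set) = {}"
proof -
  have "rk x \<le> rk (Orderings.top :: 'a)" for x :: 'a
    unfolding rk_def by (rule card_mono) auto
  then have "int (rk x) \<noteq> int (rk (Orderings.top :: 'a)) - n" for x :: 'a
    using assms by (smt (verit) of_nat_mono)
  then show ?thesis by (simp add: D_def)
qed

lemma top_in_D_iff: "(Orderings.top :: 'a::{finite, boolean_algebra}) \<in> D n \<longleftrightarrow> n = 0"
  by (simp add: D_def)

lemma D_0: "(D 0 :: 'a::{finite, boolean_algebra} set) = {Orderings.top}"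
proof -
  have "x = Orderings.top" if "x \<in> D 0" for x :: 'a
    using that rk_less [of x Orderings.top] top.not_eq_extremum [of x] by (auto simp: D_def)
  then show ?thesis using top_in_D_iff by blast
qed

lemma sup_atom_in_D:
  fixes x a :: "'a::{finite, boolean_algebra}"
  assumes "a \<in> atoms" "\<not> a \<le> x"
  shows "sup x a \<in> D n \<longleftrightarrow> x \<in> D (n + 1)"
  using assms by (auto simp: D_def rk_sup_atom)

text \<open>The sign of the cover from \<open>x\<close> to \<open>sup x a\<close>, in terms of atoms
  instead of coordinates. The count admits \<open>b = a\<close>, just as the product in
  \<open>cover_sign\<close> includes its last index; for \<open>a\<close> not below \<open>x\<close>
  that position contributes nothing.\<close>

definition atom_sign :: "('a::order_bot \<times> 'a) set \<Rightarrow> 'a \<Rightarrow> 'a \<Rightarrow> int" where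
  "atom_sign R x a = (- 1) ^ card {b \<in> atoms. (b, a) \<in> R \<and> b \<le> x}"

lemma atom_sign_square [simp]: "atom_sign R x a * atom_sign R x a = 1"
  by (simp add: atom_sign_def flip: power_add power2_eq_square power_mult)

lemma atom_sign_sup:
  fixes x a b :: "'a::{finite, boolean_algebra}"
  assumes "a \<in> atoms" "\<not> a \<le> x"
  shows "atom_sign R (sup x a) b = (if (a, b) \<in> R then - atom_sign R x b else atom_sign R x b)"
proof (cases "(a, b) \<in> R")
  case True
  have "{c \<in> atoms. (c, b) \<in> R \<and> c \<le> sup x a} = insert a {c \<in> atoms. (c, b) \<in> R \<and> c \<le> x}"
    using assms True by (auto simp: atom_le_sup atom_le_atom)
  then show ?thesis using assms True by (simp add: atom_sign_def)
next
  case False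
  have "{c \<in> atoms. (c, b) \<in> R \<and> c \<le> sup x a} = {c \<in> atoms. (c, b) \<in> R \<and> c \<le> x}"
    using assms False by (auto simp: atom_le_sup atom_le_atom)
  then show ?thesis using assms False by (simp add: atom_sign_def)
qed

text \<open>Of two distinct atoms exactly one precedes the other, so adding one of them first flips
  the sign of the second in exactly one of the two orders.\<close>

lemma atom_sign_swap:
  fixes x a b :: "'a::{finite, boolean_algebra}"
  assumes R: "linear_order_on atoms R" and "a \<in> atoms" "b \<in> atoms" "a \<noteq> b" "\<not> a \<le> x" "\<not> b \<le> x"
  shows "atom_sign R x a * atom_sign R (sup x a) b = - (atom_sign R x b * atom_sign R (sup x b) a)"
proof -
  have "(a, b) \<in> R \<longleftrightarrow> (b, a) \<notin> R"
    using assms by (auto simp: linear_order_on_def partial_order_on_def total_on_def antisym_def)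
  then show ?thesis using assms by (auto simp: atom_sign_sup)
qed

text \<open>The position function \<open>p\<close> is the bridge between the numbering of
  coordinates and the atoms. Both image claims follow by counting: \<open>p\<close> is injective and
  maps into a set of the same size.\<close>

lemma linear_order_initial_segment_card:
  assumes R: "linear_order_on A R" and "finite A"
    and p_def: "\<And>a. p a = card {b \<in> A. (b, a) \<in> R}"
  shows "inj_on p A" and "p ` A = {1..card A}"
    and "\<And>a. a \<in> A \<Longrightarrow> p ` {b \<in> A. (b, a) \<in> R} = {1..p a}"
proof -
  have refl: "\<And>a. a \<in> A \<Longrightarrow> (a, a) \<in> R" and trans: "trans R" and antisym: "antisym R"
    and total: "total_on A R"
    using R by (auto simp: linear_order_on_def partial_order_on_def preorder_on_def refl_on_def)
  have mono: "p a \<le> p b" if "(a, b) \<in> R" for a b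
    unfolding p_def using that trans \<open>finite A\<close> by (intro card_mono) (auto dest: transD)
  have less: "p a < p b" if "(a, b) \<in> R" "a \<noteq> b" "a \<in> A" "b \<in> A" for a b
    unfolding p_def
  proof (rule psubset_card_mono)
    have "(b, a) \<notin> R" using that antisym by (auto simp: antisym_def)
    then show "{c \<in> A. (c, a) \<in> R} \<subset> {c \<in> A. (c, b) \<in> R}"
      using that trans refl by (auto dest: transD)
  qed (use \<open>finite A\<close> in auto)
  show inj: "inj_on p A"
    using less total by (fastforce simp: inj_on_def total_on_def)
  have pos: "1 \<le> p a" if "a \<in> A" for a
    using that refl \<open>finite A\<close> by (auto simp: p_def Suc_le_eq card_gt_0_iff)
  have "p ` A \<subseteq> {1..card A}"
    using pos \<open>finite A\<close> by (auto simp: p_def intro!: card_mono)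
  then show "p ` A = {1..card A}"
    using inj by (intro card_subset_eq) (auto simp: card_image)
  show "p ` {b \<in> A. (b, a) \<in> R} = {1..p a}" if "a \<in> A" for a
  proof (rule card_subset_eq)
    show "p ` {b \<in> A. (b, a) \<in> R} \<subseteq> {1..p a}" using pos mono by auto
    show "card (p ` {b \<in> A. (b, a) \<in> R}) = card {1..p a}"
      using card_image [OF inj_on_subset [OF inj, of "{b \<in> A. (b, a) \<in> R}"]] by (simp add: p_def)
  qed simp
qed

text \<open>The coordinate that changes is the position \<open>p a\<close>, so the product runs over
  the positions of the atoms up to \<open>a\<close>. Reindexed by these atoms, its exponent counts
  those below \<open>x\<close>.\<close>

lemma cover_sign_sup_atom:
  fixes x a :: "'a::{finite, boolean_algebra}"
  assumes R: "linear_order_on atoms R" and a: "a \<in> atoms" "\<not> a \<le> x"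
  shows "cover_sign R x (sup x a) = atom_sign R x a"
proof -
  define p where "p a = card {b \<in> atoms. (b, a) \<in> R}" for a
  note p = linear_order_initial_segment_card [OF R finite_atoms p_def]
  \<comment> \<open>\<open>nth_atom\<close> inverts \<open>p\<close>; injectivity makes its definite
    description unique.\<close>
  have nth: "nth_atom R (p b) = b" if "b \<in> atoms" for b
    unfolding nth_atom_def
    using that inj_onD [OF p(1)] by (intro the_equality) (auto simp: p_def)
  have range: "{1..rk (Orderings.top :: 'a)} = p ` atoms"
    using p(2) by (simp add: rk_top)
  have "cover_index R x (sup x a) = p a"
    unfolding cover_index_def range
    by (rule the_equality)
      (use a in \<open>auto simp: coord_def nth atom_le_sup atom_le_atom split: if_splits\<close>)
  then have "cover_sign R x (sup x a) = (\<Prod>j\<in>p ` {b \<in> atoms. (b, a) \<in> R}. (- 1) ^ coord R j x)"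
    using p(3) [OF a(1)] by (simp add: cover_sign_def)
  also have "\<dots> = (\<Prod>b | b \<in> atoms \<and> (b, a) \<in> R. (- 1) ^ coord R (p b) x)"
    by (subst prod.reindex) (auto intro: inj_on_subset [OF p(1)])
  also have "\<dots> = (- 1) ^ (\<Sum>b | b \<in> atoms \<and> (b, a) \<in> R. coord R (p b) x)"
    by (simp only: power_sum)
  also have "(\<Sum>b | b \<in> atoms \<and> (b, a) \<in> R. coord R (p b) x)
      = (\<Sum>b | b \<in> atoms \<and> (b, a) \<in> R. if b \<le> x then 1 else 0)"
    by (intro sum.cong refl) (simp add: coord_def nth)
  also have "\<dots> = card {b \<in> atoms. (b, a) \<in> R \<and> b \<le> x}"
    by (simp add: sum.If_cases Collect_conj_eq Int_assoc)
  finally show ?thesis by (simp add: atom_sign_def)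
qed

section \<open>The matrix of the cube complex and its contractions\<close>

definition cube_diff :: "('a::{order_bot, order_top} \<times> 'a) set \<Rightarrow> 'a \<Rightarrow> 'a \<Rightarrow> int" where
  "cube_diff R x y = (if covered_by x y then cover_sign R x y else 0)"

lemma sum_cube_diff:
  fixes x :: "'a::{finite, boolean_algebra}"
  assumes R: "linear_order_on atoms R" and x: "x \<in> D n"
  shows "(\<Sum>y\<in>D (n - 1). cube_diff R x y * v y)
    = (\<Sum>a | a \<in> atoms \<and> \<not> a \<le> x. atom_sign R x a * v (sup x a))"
proof -
  let ?A = "{a \<in> atoms. \<not> a \<le> x}"
  have "inj_on (sup x) ?A"
  proof (rule inj_onI)
    fix a b assume ab: "a \<in> ?A" "b \<in> ?A" "sup x a = sup x b"
    then have "a \<le> sup x b" by (metis sup_ge2)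
    then show "a = b" using ab by (simp add: atom_le_sup atom_le_atom)
  qed
  then have "(\<Sum>a\<in>?A. atom_sign R x a * v (sup x a)) = (\<Sum>a\<in>?A. cube_diff R x (sup x a) * v (sup x a))"
    by (intro sum.cong refl) (auto simp: cube_diff_def covered_by_iff cover_sign_sup_atom [OF R])
  also have "\<dots> = (\<Sum>y\<in>sup x ` ?A. cube_diff R x y * v y)"
    using \<open>inj_on (sup x) ?A\<close> by (simp add: sum.reindex)
  also have "\<dots> = (\<Sum>y\<in>D (n - 1). cube_diff R x y * v y)"
    using x by (intro sum.mono_neutral_left) (auto simp: sup_atom_in_D cube_diff_def covered_by_iff)
  finally show ?thesis ..
qed

lemma sup_inf_compl_atom:
  fixes a y :: "'a::boolean_algebra"
  assumes "a \<le> y"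
  shows "sup (inf y (- a)) a = y"
  using assms by (simp add: sup_inf_distrib2 sup_absorb1)

text \<open>A column of the matrix: the elements covered by \<open>y\<close> are obtained by
  removing one atom \<open>a \<le> y\<close>, that is, as \<open>inf y (- a)\<close>.\<close>

lemma sum_cube_diff':
  fixes y :: "'a::{finite, boolean_algebra}"
  assumes R: "linear_order_on atoms R" and y: "y \<in> D (n - 1)"
  shows "(\<Sum>x\<in>D n. u x * cube_diff R x y)
    = (\<Sum>a | a \<in> atoms \<and> a \<le> y. u (inf y (- a)) * atom_sign R (inf y (- a)) a)"
proof -
  let ?A = "{a \<in> atoms. a \<le> y}" and ?h = "\<lambda>a. inf y (- a)"
  have atom_le: "b \<le> ?h a \<longleftrightarrow> b \<le> y \<and> b \<noteq> a" if "a \<in> atoms" "b \<in> atoms" for a b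
    using that by (auto simp: atom_le_compl atom_le_atom)
  have inj: "inj_on ?h ?A"
  proof (rule inj_onI)
    fix a b assume ab: "a \<in> ?A" "b \<in> ?A" "?h a = ?h b"
    then show "a = b" using atom_le [of a a] atom_le [of b a] by auto
  qed
  have h: "\<not> a \<le> ?h a" "sup (?h a) a = y" if "a \<in> ?A" for a
    using that atom_le [of a a] sup_inf_compl_atom by auto
  have "(\<Sum>a\<in>?A. u (?h a) * atom_sign R (?h a) a) = (\<Sum>a\<in>?A. u (?h a) * cube_diff R (?h a) y)"
  proof (rule sum.cong)
    fix a assume a: "a \<in> ?A"
    then have "covered_by (?h a) y" using h [OF a] covered_by_iff by force
    moreover have "cover_sign R (?h a) y = atom_sign R (?h a) a"
      using cover_sign_sup_atom [OF R, of a "?h a"] h [OF a] a by simp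
    ultimately show "u (?h a) * atom_sign R (?h a) a = u (?h a) * cube_diff R (?h a) y"
      by (simp add: cube_diff_def)
  qed simp
  also have "\<dots> = (\<Sum>x\<in>?h ` ?A. u x * cube_diff R x y)"
    using inj by (simp add: sum.reindex)
  also have "\<dots> = (\<Sum>x\<in>D n. u x * cube_diff R x y)"
  proof (rule sum.mono_neutral_left)
    show "?h ` ?A \<subseteq> D n"
      using y h sup_atom_in_D [of _ _ "n - 1"] by fastforce
    show "\<forall>x\<in>D n - ?h ` ?A. u x * cube_diff R x y = 0"
    proof (rule ballI, rule ccontr)
      fix x assume x: "x \<in> D n - ?h ` ?A" "u x * cube_diff R x y \<noteq> 0"
      then obtain a where a: "a \<in> atoms" "\<not> a \<le> x" "y = sup x a"
        by (auto simp: cube_diff_def covered_by_iff split: if_splits)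
      then have "x = ?h a"
        by (subst eq_iff_atoms) (use atom_le [of a] in \<open>auto simp: atom_le_sup atom_le_atom\<close>)
      then show False using x a by auto
    qed
  qed simp
  finally show ?thesis ..
qed

text \<open>The witness is the contraction that removes \<open>m\<close>, with the sign of the
  corresponding cover. At \<open>y \<ge> m\<close> its boundary returns \<open>w y\<close> at once;
  at the other \<open>y\<close> the cycle condition at \<open>sup y m\<close> is needed, and
  anticommuting signs match it with the contracted terms.\<close>

lemma cube_exact:
  fixes x m :: "'a::{finite, boolean_algebra}"
  assumes R: "linear_order_on atoms R" and m: "m \<in> atoms"
    and cycle: "\<And>z. z \<in> D (n - 1) \<Longrightarrow> (\<Sum>y\<in>D n. w y * cube_diff R y z) = 0"
    and y: "y \<in> D n"
  shows "(\<Sum>z\<in>D (n + 1). (if m \<le> z then 0 else w (sup z m) * atom_sign R z m) * cube_diff R z y) = w y"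
    (is "(\<Sum>z\<in>_. ?u z * _) = _")
proof -
  let ?h = "\<lambda>a. inf y (- a)"
  have S: "(\<Sum>z\<in>D (n + 1). ?u z * cube_diff R z y)
    = (\<Sum>a | a \<in> atoms \<and> a \<le> y. ?u (?h a) * atom_sign R (?h a) a)"
    using y by (intro sum_cube_diff' [OF R]) simp
  show ?thesis
  proof (cases "m \<le> y")
    case True
    \<comment> \<open>For \<open>a \<noteq> m\<close> the element \<open>?h a\<close> is still above
      \<open>m\<close>, where \<open>?u\<close> is \<open>0\<close>; the term \<open>a = m\<close>
      carries the same sign twice.\<close>
    have "(\<Sum>a | a \<in> atoms \<and> a \<le> y. ?u (?h a) * atom_sign R (?h a) a)
        = (\<Sum>a\<in>{m}. ?u (?h a) * atom_sign R (?h a) a)"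
      using True m by (intro sum.mono_neutral_right) (auto simp: atom_le_compl atom_le_atom)
    also have "\<dots> = w y"
      using True m by (simp add: atom_le_compl sup_inf_compl_atom mult.assoc)
    finally show ?thesis using S by simp
  next
    case False
    let ?B = "{a \<in> atoms. a \<le> y}" and ?y = "sup y m" and ?s = "atom_sign R"
    \<comment> \<open>Removing \<open>m\<close> from \<open>?y\<close> gives back \<open>y\<close>;
      removing another atom \<open>a\<close> gives \<open>sup (?h a) m\<close>, the argument of
      \<open>w\<close> in \<open>?u (?h a)\<close>.\<close>
    have "?y \<in> D (n - 1)" using False m y by (simp add: sup_atom_in_D)
    then have "0 = (\<Sum>a | a \<in> atoms \<and> a \<le> ?y. w (inf ?y (- a)) * ?s (inf ?y (- a)) a)"
      using cycle [of ?y] sum_cube_diff' [OF R, of ?y n w] by simp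
    also have "{a \<in> atoms. a \<le> ?y} = insert m ?B"
      using m by (auto simp: atom_le_sup atom_le_atom)
    also have "(\<Sum>a\<in>insert m ?B. w (inf ?y (- a)) * ?s (inf ?y (- a)) a)
        = w (inf ?y (- m)) * ?s (inf ?y (- m)) m + (\<Sum>a\<in>?B. w (inf ?y (- a)) * ?s (inf ?y (- a)) a)"
      using False by simp
    also have "inf ?y (- m) = y"
      using False m by (subst eq_iff_atoms) (auto simp: atom_le_sup atom_le_atom atom_le_compl)
    also have "(\<Sum>a\<in>?B. w (inf ?y (- a)) * ?s (inf ?y (- a)) a)
        = (\<Sum>a\<in>?B. - ?s y m * (?u (?h a) * ?s (?h a) a))"
    proof (rule sum.cong)
      fix a assume a: "a \<in> ?B"
      then have am: "a \<noteq> m" "\<not> m \<le> ?h a" "\<not> a \<le> ?h a"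
        using False m by (auto simp: atom_le_compl)
      have 1: "inf ?y (- a) = sup (?h a) m"
        using a am m by (subst eq_iff_atoms) (auto simp: atom_le_sup atom_le_atom atom_le_compl)
      have 2: "sup (?h a) a = y" using a by (intro sup_inf_compl_atom) simp
      have "?s (?h a) m * ?s (sup (?h a) m) a = - (?s (?h a) a * ?s y m)"
        using atom_sign_swap [OF R m, of a "?h a"] a am unfolding 2 by auto
      \<comment> \<open>Multiplication by \<open>?s (?h a) m\<close>, whose square is
        \<open>1\<close>, isolates the sign at \<open>sup (?h a) m\<close>.\<close>
      then have "?s (?h a) m * (?s (?h a) m * ?s (sup (?h a) m) a) = - (?s (?h a) m * ?s (?h a) a * ?s y m)"
        by simp
      then have 3: "?s (sup (?h a) m) a = - (?s (?h a) m * ?s (?h a) a * ?s y m)"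
        by (simp add: mult.assoc [symmetric] del: mult_minus_right)
      then show "w (inf ?y (- a)) * ?s (inf ?y (- a)) a = - ?s y m * (?u (?h a) * ?s (?h a) a)"
        unfolding 1 3 using am(2) by (simp only: if_False) simp
    qed simp
    also have "\<dots> = - ?s y m * (\<Sum>a\<in>?B. ?u (?h a) * ?s (?h a) a)"
      by (rule sum_distrib_left [symmetric])
    finally have "?s y m * (w y - (\<Sum>a\<in>?B. ?u (?h a) * ?s (?h a) a)) = 0"
      by (simp only: right_diff_distrib) simp
    moreover have "?s y m \<noteq> 0" by (simp add: atom_sign_def)
    ultimately show ?thesis using S by simp
  qed
qed

lemma cube_resolution:
  fixes R :: "('a::{finite, boolean_algebra} \<times> 'a) set"
  assumes R: "linear_order_on atoms R"
  shows "labelled_resolution (Orderings.top :: 'a) D (\<lambda>x. x) (cube_diff R)"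
proof
  show "finite (D n :: 'a set)" for n by simp
  show "(D n :: 'a set) = {}" if "n < 0" for n using that by (rule D_neg)
  show "\<exists>s. (D 0 :: 'a set) = {s} \<and> s = Orderings.top" using D_0 by simp
  show "x \<noteq> Orderings.top" if "n > 0" "x \<in> D n" for n and x :: 'a
    using that top_in_D_iff [of n] by auto
  show "mat_mono (D n) (D (n - 1)) (\<lambda>x. x) (\<lambda>x. x) (cube_diff R)" for n
    by (auto simp: mat_mono_def cube_diff_def covered_by_def)
  show "mat_prod (D (n - 1)) (cube_diff R) (cube_diff R) x z = 0"
    if x: "x \<in> D n" and "z \<in> D (n - 2)" for n x z
  proof -
    let ?A = "{a \<in> atoms. \<not> a \<le> x}" and ?s = "atom_sign R"
    have "mat_prod (D (n - 1)) (cube_diff R) (cube_diff R) x z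
        = (\<Sum>a\<in>?A. ?s x a * cube_diff R (sup x a) z)"
      unfolding mat_prod_def using R x by (rule sum_cube_diff)
    also have "\<dots> = (\<Sum>a\<in>?A. \<Sum>b\<in>?A - {a}. if z = sup (sup x a) b then ?s x a * ?s (sup x a) b else 0)"
    proof (rule sum.cong)
      fix a assume a: "a \<in> ?A"
      have A: "{b \<in> atoms. \<not> b \<le> sup x a} = ?A - {a}"
        using a by (auto simp: atom_le_sup atom_le_atom)
      have "sup x a \<in> D (n - 1)" using a x by (simp add: sup_atom_in_D)
      \<comment> \<open>Taking the indicator function of \<open>z\<close> as \<open>v\<close> turns
        the row formula into one for a single matrix entry.\<close>
      then have "(\<Sum>y\<in>D (n - 1 - 1). cube_diff R (sup x a) y * (if z = y then 1 else 0))
          = (\<Sum>b\<in>?A - {a}. ?s (sup x a) b * (if z = sup (sup x a) b then 1 else 0))"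
        using sum_cube_diff [OF R, of "sup x a" "n - 1" "\<lambda>y. if z = y then 1 else 0"] unfolding A by blast
      moreover have "(\<Sum>y\<in>D (n - 1 - 1). cube_diff R (sup x a) y * (if z = y then 1 else 0))
          = cube_diff R (sup x a) z"
        using that by (simp add: sum.delta if_distrib cong: if_cong)
      ultimately have "cube_diff R (sup x a) z
          = (\<Sum>b\<in>?A - {a}. ?s (sup x a) b * (if z = sup (sup x a) b then 1 else 0))" by simp
      then show "?s x a * cube_diff R (sup x a) z
          = (\<Sum>b\<in>?A - {a}. if z = sup (sup x a) b then ?s x a * ?s (sup x a) b else 0)"
        by (simp only: sum_distrib_left) (intro sum.cong refl, simp)
    qed simp
    also have "\<dots> = 0"
    proof (rule sum_antisymmetric)
      fix a b assume "a \<in> ?A" "b \<in> ?A" "a \<noteq> b"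
      moreover have "sup (sup x a) b = sup (sup x b) a"
        by (simp add: sup_assoc sup_commute sup_left_commute)
      ultimately show "(if z = sup (sup x a) b then ?s x a * ?s (sup x a) b else 0)
          = - (if z = sup (sup x b) a then ?s x b * ?s (sup x b) a else 0)"
        using atom_sign_swap [OF R, of a b x] by simp
    qed simp
    finally show ?thesis .
  qed
  fix x :: 'a and w :: "'a \<Rightarrow> int" and n
  assume "x \<noteq> Orderings.top"
    and w: "\<And>y. w y \<noteq> 0 \<Longrightarrow> y \<in> D n \<and> x \<le> y"
    and cycle: "\<And>z. z \<in> D (n - 1) \<Longrightarrow> (\<Sum>y\<in>D n. w y * cube_diff R y z) = 0"
  then obtain m where m: "m \<in> atoms" "\<not> m \<le> x"
    using not_le_imp_atom [of Orderings.top x] by (auto simp: top_unique)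
  show "\<exists>u. (\<forall>z\<in>D (n + 1). u z \<noteq> 0 \<longrightarrow> x \<le> z) \<and>
      (\<forall>y\<in>D n. (\<Sum>z\<in>D (n + 1). u z * cube_diff R z y) = w y)"
  proof (intro exI conjI ballI impI)
    show "(\<Sum>z\<in>D (n + 1). (if m \<le> z then 0 else w (sup z m) * atom_sign R z m) * cube_diff R z y) = w y"
      if "y \<in> D n" for y
      using R m(1) cycle that by (rule cube_exact)
    fix z assume "(if m \<le> z then 0 else w (sup z m) * atom_sign R z m) \<noteq> 0"
    then have "x \<le> sup z m" using w by (auto split: if_splits)
    \<comment> \<open>This is why \<open>m\<close> is chosen not below \<open>x\<close>: every atom
      of \<open>x\<close> lies below \<open>sup z m\<close> and differs from \<open>m\<close>, hence
      lies below \<open>z\<close>.\<close>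
    then show "x \<le> z"
      using m by (auto simp: le_iff_atoms [of x] atom_le_sup atom_le_atom)
  qed
qed

section \<open>Comparison with the defined complexes\<close>

lemma homology_cong:
  assumes "\<And>n x. x \<in> carrier (C n) \<Longrightarrow> d n x = d' n x"
  shows "homology C d n = homology C d' n"
proof -
  have "kernel (C n) (C (n - 1)) (d n) = kernel (C n) (C (n - 1)) (d' n)"
    using assms by (auto simp: kernel_def)
  moreover have "d (n + 1) ` carrier (C (n + 1)) = d' (n + 1) ` carrier (C (n + 1))"
    using assms by auto
  ultimately show ?thesis by (simp add: homology_def)
qed

text \<open>Coordinate projections are homomorphisms, so both differentials can be computed one
  coordinate at a time.\<close>

lemma (in ab_diagram) finprod_dsum:
  assumes "finite A" "finite S" "j \<in> A" "h \<in> S \<rightarrow> carrier (dsum l A)"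
  shows "finprod (dsum l A) h S j = finprod (F (l j)) (\<lambda>i. h i j) S"
proof (rule hom_finprod [where h = "\<lambda>c. c j"])
  show "(\<lambda>c. c j) \<in> hom (dsum l A) (F (l j))"
    using assms(1,3) by (intro homI) (auto simp: carrier_dsum)
qed (use assms in \<open>auto intro: comm_group_dsum\<close>)

lemma (in ab_diagram) summand_incl_closed:
  assumes "finite A" "i \<in> A \<Longrightarrow> g \<in> carrier (F (l i))"
  shows "summand_incl A (\<lambda>i. F (l i)) i g \<in> carrier (dsum l A)"
  using assms by (auto simp: carrier_dsum summand_incl_def group.is_monoid monoid.one_closed)

lemma gfinprod_finprod:
  assumes "comm_group G" "finite A" "h \<in> A \<rightarrow> carrier G"
  shows "gfinprod G h A = finprod G h A"
  using assms by (simp add: comm_group_def comm_monoid.gfinprod_eq_finprod)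

text \<open>\<open>vertex \<sigma>\<close> inverts the map that counts the elements below a given
  one; this map is injective by \<open>vertex_eqI\<close>, and by counting it is onto the numbers
  below \<open>card \<sigma>\<close>.\<close>

lemma vertex_bij_betw:
  fixes \<sigma> :: "'a::order set"
  assumes chain: "Complete_Partial_Order.chain (\<le>) \<sigma>" and fin: "finite \<sigma>"
  shows "bij_betw (vertex \<sigma>) {..<card \<sigma>} \<sigma>"
    and "\<And>i. i < card \<sigma> \<Longrightarrow> card {y \<in> \<sigma>. y < vertex \<sigma> i} = i"
proof -
  define p where "p x = card {y \<in> \<sigma>. y < x}" for x
  have v: "vertex \<sigma> (p x) = x" if "x \<in> \<sigma>" for x
    using vertex_eqI [OF chain fin that] by (simp add: p_def)
  have inj: "inj_on p \<sigma>" by (rule inj_on_inverseI) (rule v)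
  have "p x < card \<sigma>" if "x \<in> \<sigma>" for x
    unfolding p_def using that fin by (intro psubset_card_mono) auto
  then have im: "p ` \<sigma> = {..<card \<sigma>}"
    using inj by (intro card_subset_eq) (auto simp: card_image)
  have "bij_betw p \<sigma> {..<card \<sigma>}" using inj im by (simp add: bij_betw_def)
  moreover have "p (vertex \<sigma> i) = i \<and> vertex \<sigma> i \<in> \<sigma>" if i: "i < card \<sigma>" for i
  proof -
    obtain x where "x \<in> \<sigma>" "i = p x" using im i by (metis imageE lessThan_iff)
    then show ?thesis using v by simp
  qed
  ultimately show "bij_betw (vertex \<sigma>) {..<card \<sigma>} \<sigma>"
    using v by (intro bij_betw_byWitness [where f' = p]) (auto simp: bij_betw_def)
  show "card {y \<in> \<sigma>. y < vertex \<sigma> i} = i" if "i < card \<sigma>" for i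
    using \<open>\<And>i. i < card \<sigma> \<Longrightarrow> p (vertex \<sigma> i) = i \<and> vertex \<sigma> i \<in> \<sigma>\<close> [OF that]
    by (simp add: p_def)
qed

lemma pos_sign_vertex:
  fixes \<sigma> :: "'a::order set"
  assumes "Complete_Partial_Order.chain (\<le>) \<sigma>" "finite \<sigma>" "i < card \<sigma>"
  shows "pos_sign \<sigma> (vertex \<sigma> i) = (- 1) ^ i"
  using vertex_bij_betw(2) [OF assms] by (simp add: pos_sign_def)

lemma
  fixes \<sigma> :: "'a::order set"
  assumes chain: "Complete_Partial_Order.chain (\<le>) \<sigma>" and fin: "finite \<sigma>" and i: "i < card \<sigma>"
  shows vertex_0_remove_0: "i = 1 \<Longrightarrow> vertex (\<sigma> - {vertex \<sigma> 0}) 0 = vertex \<sigma> 1"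
    and vertex_0_remove: "i > 0 \<Longrightarrow> vertex (\<sigma> - {vertex \<sigma> i}) 0 = vertex \<sigma> 0"
    and vertex_0_le: "vertex \<sigma> 0 \<le> vertex \<sigma> i"
proof -
  have mem: "vertex \<sigma> j \<in> \<sigma>" if "j < card \<sigma>" for j
    using vertex_bij_betw(1) [OF chain fin] that by (auto simp: bij_betw_def)
  have neq: "vertex \<sigma> j \<noteq> vertex \<sigma> k" if "j < card \<sigma>" "k < card \<sigma>" "j \<noteq> k" for j k
    using vertex_bij_betw(1) [OF chain fin] that by (auto simp: bij_betw_def inj_on_def)
  have least: "vertex \<sigma> 0 \<le> y" if "y \<in> \<sigma>" for y
    using le_vertex_0_iff [OF fin _ chain, of "vertex \<sigma> 0"] that by auto
  show "vertex \<sigma> 0 \<le> vertex \<sigma> i" using mem i by (intro least)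
  show "vertex (\<sigma> - {vertex \<sigma> i}) 0 = vertex \<sigma> 0" if "i > 0"
    using that i mem [of 0] neq [of 0 i] least fin chain
    by (intro vertex_0_eqI) (auto intro: chain_subset)
  show "vertex (\<sigma> - {vertex \<sigma> 0}) 0 = vertex \<sigma> 1" if "i = 1"
  proof (rule vertex_eqI)
    have "{y \<in> \<sigma>. y < vertex \<sigma> 1} = insert (vertex \<sigma> 0) {y \<in> \<sigma> - {vertex \<sigma> 0}. y < vertex \<sigma> 1}"
      using that i mem [of 0] neq [of 0 1] least [of "vertex \<sigma> 1"] mem [of 1]
      by (auto simp: order.order_iff_strict)
    then have "card {y \<in> \<sigma>. y < vertex \<sigma> 1} = Suc (card {y \<in> \<sigma> - {vertex \<sigma> 0}. y < vertex \<sigma> 1})"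
      using fin by (metis (no_types, lifting) DiffE card_insert_disjoint finite_Diff finite_subset insertCI mem_Collect_eq subsetI)
    then show "card {y \<in> \<sigma> - {vertex \<sigma> 0}. y < vertex \<sigma> 1} = 0"
      using vertex_bij_betw(2) [OF chain fin, of 1] that i by simp
  qed (use that i mem neq [of 0 1] chain fin in \<open>auto intro: chain_subset\<close>)
qed

lemma Ch_iff:
  fixes \<sigma> :: "'a::{finite, order} set"
  shows "\<sigma> \<in> Ch UNIV n \<longleftrightarrow> n \<ge> 0 \<and> Complete_Partial_Order.chain (\<le>) \<sigma> \<and> int (card \<sigma>) = n + 1"
  by (auto simp: Ch_def)

section \<open>The relative complex as the complex of chains containing \<open>1\<close>\<close>

locale top_diagram = ab_diagram F f
  for F :: "'a::{finite, order_top} \<Rightarrow> 'b monoid" and f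
begin

lemma C_group_eq: "C_group UNIV F n = dsum (\<lambda>\<sigma>. vertex \<sigma> 0) (Ch UNIV n)"
  by (simp add: C_group_def)

lemma comm_group_C_group: "comm_group (C_group UNIV F n)"
  unfolding C_group_eq by (rule comm_group_dsum)

lemma C_carrierD:
  "c \<in> carrier (C_group UNIV F n) \<Longrightarrow> \<sigma> \<in> Ch UNIV n \<Longrightarrow> c \<sigma> \<in> carrier (F (vertex \<sigma> 0))"
  by (auto simp: C_group_eq carrier_dsum)

text \<open>
  For \<open>i > 0\<close> the minimum does not change and \<open>act\<close> is a power because \<open>f x x\<close> is the identity, so
  this covers both cases of \<^const>\<open>C_diff_summand\<close>.
\<close>

definition face_term :: "int \<Rightarrow> 'a set \<Rightarrow> 'b \<Rightarrow> nat \<Rightarrow> 'a set \<Rightarrow> 'b" where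
  "face_term n \<sigma> g i = C_incl UNIV F (n - 1) (\<sigma> - {vertex \<sigma> i})
     (act (vertex \<sigma> 0) (vertex (\<sigma> - {vertex \<sigma> i}) 0) ((- 1) ^ i) g)"

lemma face_term_closed:
  assumes "g \<in> carrier (F (vertex \<sigma> 0))"
  shows "face_term n \<sigma> g i \<in> carrier (C_group UNIV F (n - 1))"
  unfolding face_term_def C_group_eq C_incl_def
  using assms by (intro summand_incl_closed act_closed) auto

lemma C_diff_summand_eq:
  assumes \<sigma>: "\<sigma> \<in> Ch UNIV n" and n: "n > 0" and g: "g \<in> carrier (F (vertex \<sigma> 0))"
  shows "C_diff_summand UNIV F f n \<sigma> g
    = finprod (C_group UNIV F (n - 1)) (face_term n \<sigma> g) {..<card \<sigma>}"
proof -
  interpret G: comm_group "C_group UNIV F (n - 1)" by (rule comm_group_C_group)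
  have chain: "Complete_Partial_Order.chain (\<le>) \<sigma>" and card: "int (card \<sigma>) = n + 1" and fin: "finite \<sigma>"
    using \<sigma> by (auto simp: Ch_iff)
  have closed: "face_term n \<sigma> g i \<in> carrier (C_group UNIV F (n - 1))" for i
    using g by (rule face_term_closed)
  have 0: "C_incl UNIV F (n - 1) (\<sigma> - {vertex \<sigma> 0}) (f (vertex \<sigma> 0) (vertex \<sigma> 1) g) = face_term n \<sigma> g 0"
    using vertex_0_remove_0 [OF chain fin, of 1] vertex_0_le [OF chain fin, of 1] card n g
    by (simp add: face_term_def act_def group.int_pow_1 f_closed)
  have "C_incl UNIV F (n - 1) (\<sigma> - {vertex \<sigma> i}) (g [^]\<^bsub>F (vertex \<sigma> 0)\<^esub> ((- 1 :: int) ^ i)) = face_term n \<sigma> g i"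
    if "i \<in> {1..nat n}" for i
  proof -
    have "vertex (\<sigma> - {vertex \<sigma> i}) 0 = vertex \<sigma> 0"
      using that card by (intro vertex_0_remove [OF chain fin]) auto
    then show ?thesis using g by (simp add: face_term_def act_def f_id)
  qed
  then have "C_diff_summand UNIV F f n \<sigma> g = face_term n \<sigma> g 0 \<otimes>\<^bsub>C_group UNIV F (n - 1)\<^esub>
      finprod (C_group UNIV F (n - 1)) (face_term n \<sigma> g) {1..nat n}"
    unfolding C_diff_summand_def 0 using closed by (intro arg_cong2 [where f = "(\<otimes>\<^bsub>_\<^esub>)"] refl G.finprod_cong') auto
  also have "\<dots> = finprod (C_group UNIV F (n - 1)) (face_term n \<sigma> g) (insert 0 {1..nat n})"
    using closed by (intro G.finprod_insert [symmetric]) auto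
  also have "insert 0 {1..nat n} = {..<card \<sigma>}"
    using card n by auto
  finally show ?thesis .
qed

lemma C_diff_summand_closed:
  assumes "\<sigma> \<in> Ch UNIV n" "n > 0" "g \<in> carrier (F (vertex \<sigma> 0))"
  shows "C_diff_summand UNIV F f n \<sigma> g \<in> carrier (C_group UNIV F (n - 1))"
proof -
  interpret G: comm_group "C_group UNIV F (n - 1)" by (rule comm_group_C_group)
  show ?thesis
    unfolding C_diff_summand_eq [OF assms] using face_term_closed [OF assms(3)]
    by (intro G.finprod_closed) auto
qed

text \<open>Reindexing from positions to vertices turns the face signs into \<open>pos_sign\<close>,
  so the coefficient at \<open>\<rho>\<close> becomes the defining sum of
  \<open>incidence\<close>.\<close>

lemma C_diff_summand_apply:
  assumes \<sigma>: "\<sigma> \<in> Ch UNIV n" and n: "n > 0" and g: "g \<in> carrier (F (vertex \<sigma> 0))"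
    and \<rho>: "\<rho> \<in> top_chains (n - 1)"
  shows "C_diff_summand UNIV F f n \<sigma> g \<rho> = act (vertex \<sigma> 0) (vertex \<rho> 0) (incidence \<sigma> \<rho>) g"
proof -
  interpret G: comm_group "F (vertex \<rho> 0)" by simp
  have chain: "Complete_Partial_Order.chain (\<le>) \<sigma>" and fin: "finite \<sigma>"
    using \<sigma> by (auto simp: Ch_iff)
  have \<rho>': "\<rho> \<in> Ch UNIV (n - 1)" and top: "Orderings.top \<in> \<rho>"
    using \<rho> by (auto simp: top_chains_def)
  let ?t = "\<lambda>x. act (vertex \<sigma> 0) (vertex \<rho> 0) (if \<rho> = \<sigma> - {x} then pos_sign \<sigma> x else 0) g"
  have t: "?t x \<in> carrier (F (vertex \<rho> 0))" for x using g by (rule act_closed)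
  have "C_diff_summand UNIV F f n \<sigma> g \<rho>
      = finprod (F (vertex \<rho> 0)) (\<lambda>i. face_term n \<sigma> g i \<rho>) {..<card \<sigma>}"
    unfolding C_diff_summand_eq [OF \<sigma> n g] C_group_eq
    using \<rho>' face_term_closed [OF g] by (intro finprod_dsum) (auto simp: C_group_eq)
  also have "\<dots> = finprod (F (vertex \<rho> 0)) (\<lambda>i. ?t (vertex \<sigma> i)) {..<card \<sigma>}"
    using \<rho>' t by (intro G.finprod_cong')
      (auto simp: face_term_def C_incl_def summand_incl_def pos_sign_vertex [OF chain fin])
  also have "\<dots> = finprod (F (vertex \<rho> 0)) ?t \<sigma>"
    using vertex_bij_betw(1) [OF chain fin] t
      G.finprod_reindex [of ?t "vertex \<sigma>" "{..<card \<sigma>}"] by (auto simp: bij_betw_def)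
  \<comment> \<open>The face omitting \<open>1\<close> cannot equal \<open>\<rho>\<close>, which
    contains \<open>1\<close>, so its factor is neutral.\<close>
  also have "\<dots> = finprod (F (vertex \<rho> 0)) ?t (\<sigma> - {Orderings.top})"
    using t top fin by (intro G.finprod_mono_neutral_cong_right) auto
  also have "\<dots> = act (vertex \<sigma> 0) (vertex \<rho> 0) (incidence \<sigma> \<rho>) g"
    unfolding incidence_def using g fin by (intro act_sum [symmetric]) auto
  finally show ?thesis .
qed

lemma C_diff_eq:
  assumes "n > 0" "c \<in> carrier (C_group UNIV F n)"
  shows "C_diff UNIV F f n c
    = finprod (C_group UNIV F (n - 1)) (\<lambda>\<sigma>. C_diff_summand UNIV F f n \<sigma> (c \<sigma>)) (Ch UNIV n)"
  using assms C_diff_summand_closed C_carrierD [OF assms(2)]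
  by (simp add: C_diff_def gfinprod_finprod [OF comm_group_C_group] Pi_def)

lemma C_diff_closed:
  assumes "c \<in> carrier (C_group UNIV F n)"
  shows "C_diff UNIV F f n c \<in> carrier (C_group UNIV F (n - 1))"
proof -
  interpret G: comm_group "C_group UNIV F (n - 1)" by (rule comm_group_C_group)
  show ?thesis
  proof (cases "n > 0")
    case True
    then show ?thesis
      unfolding C_diff_eq [OF True assms]
      using C_diff_summand_closed C_carrierD [OF assms] by (intro G.finprod_closed) auto
  next
    case False
    then show ?thesis by (simp add: C_diff_def)
  qed
qed

abbreviation top_realize :: "int \<Rightarrow> ('a set \<Rightarrow> 'b) \<Rightarrow> ('a set \<Rightarrow> 'b)" where
  "top_realize n \<equiv> realize (\<lambda>\<sigma>. vertex \<sigma> 0) (\<lambda>\<sigma>. vertex \<sigma> 0) (top_chains n) (top_chains (n - 1)) incidence"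

text \<open>A chain avoiding \<open>1\<close> has no face containing \<open>1\<close>, so after
  restriction only the chains containing \<open>1\<close> contribute.\<close>

lemma restrict_C_diff:
  assumes c: "c \<in> carrier (C_group UNIV F n)"
  shows "restrict (C_diff UNIV F f n c) (top_chains (n - 1)) = top_realize n (restrict c (top_chains n))"
proof (cases "n > 0")
  case True
  show ?thesis
    unfolding realize_def
  proof (rule restrict_ext)
    fix \<rho> :: "'a set" assume \<rho>: "\<rho> \<in> top_chains (n - 1)"
    interpret G: comm_group "F (vertex \<rho> 0)" by simp
    let ?t = "\<lambda>\<sigma>. act (vertex \<sigma> 0) (vertex \<rho> 0) (incidence \<sigma> \<rho>) (c \<sigma>)"
    have t: "?t \<sigma> \<in> carrier (F (vertex \<rho> 0))" if "\<sigma> \<in> Ch UNIV n" for \<sigma>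
      using C_carrierD [OF c that] by (rule act_closed)
    have "C_diff UNIV F f n c \<rho> = finprod (F (vertex \<rho> 0)) (\<lambda>\<sigma>. C_diff_summand UNIV F f n \<sigma> (c \<sigma>) \<rho>) (Ch UNIV n)"
      unfolding C_diff_eq [OF True c] C_group_eq
      using \<rho> C_diff_summand_closed [OF _ True] C_carrierD [OF c]
      by (intro finprod_dsum) (auto simp: C_group_eq top_chains_def)
    also have "\<dots> = finprod (F (vertex \<rho> 0)) ?t (Ch UNIV n)"
      using t C_diff_summand_apply [OF _ True _ \<rho>] C_carrierD [OF c] by (intro G.finprod_cong') auto
    also have "\<dots> = finprod (F (vertex \<rho> 0))
        (\<lambda>\<sigma>. act (vertex \<sigma> 0) (vertex \<rho> 0) (incidence \<sigma> \<rho>) (restrict c (top_chains n) \<sigma>)) (top_chains n)"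
    proof (rule G.finprod_mono_neutral_cong_right)
      show "?t \<sigma> = \<one>\<^bsub>F (vertex \<rho> 0)\<^esub>" if "\<sigma> \<in> Ch UNIV n - top_chains n" for \<sigma>
      proof -
        have "incidence \<sigma> \<rho> = 0"
          using that \<rho> by (intro ccontr [of "_ = _"]) (auto elim!: incidence_nonzeroE simp: top_chains_def)
        then show ?thesis by simp
      qed
    qed (use t in \<open>auto simp: top_chains_def\<close>)
    finally show "C_diff UNIV F f n c \<rho> = finprod (F (vertex \<rho> 0))
        (\<lambda>\<sigma>. act (vertex \<sigma> 0) (vertex \<rho> 0) (incidence \<sigma> \<rho>) (restrict c (top_chains n) \<sigma>)) (top_chains n)" .
  qed
next
  case False
  \<comment> \<open>For \<open>n \<le> 0\<close> the target has an empty index set, so both sides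
    are the empty function.\<close>
  then have "(top_chains (n - 1) :: 'a set set) = {}" by (auto simp: top_chains_def Ch_def)
  then show ?thesis unfolding realize_def by (intro restrict_ext) auto
qed

lemma Ch_minus_top: "\<sigma> \<in> Ch (UNIV - {Orderings.top :: 'a}) n \<longleftrightarrow> \<sigma> \<in> Ch UNIV n \<and> Orderings.top \<notin> \<sigma>"
  by (auto simp: Ch_def)

text \<open>A chain lies in \<open>L - {1}\<close> exactly when it avoids \<open>1\<close>, so the
  subcomplex consists of the elements that are trivial at all chains containing \<open>1\<close>.
  This lets restriction play the part of the quotient map.\<close>

lemma C_sub_eq_kernel:
  "C_sub UNIV (UNIV - {Orderings.top}) F n = kernel (C_group UNIV F n)
     (dsum (\<lambda>\<sigma>. vertex \<sigma> 0) (top_chains n)) (\<lambda>c. restrict c (top_chains n))"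
    (is "?L = ?R")
proof (intro subset_antisym subsetI)
  let ?A = "UNIV - {Orderings.top :: 'a}"
  have carrier_A: "carrier (C_group ?A F n) = (\<Pi>\<^sub>E \<sigma>\<in>Ch ?A n. carrier (F (vertex \<sigma> 0)))"
    by (simp add: C_group_def carrier_dsum)
  show "c \<in> ?R" if c_in: "c \<in> ?L" for c
  proof -
    obtain b where b: "b \<in> carrier (C_group ?A F n)"
      and c: "c = (\<lambda>\<sigma>\<in>Ch UNIV n. if \<sigma> \<in> Ch ?A n then b \<sigma> else \<one>\<^bsub>F (vertex \<sigma> 0)\<^esub>)"
      using c_in by (auto simp: C_sub_def)
    have "c \<in> carrier (C_group UNIV F n)"
      using b by (auto simp: c carrier_A C_group_eq carrier_dsum group.is_monoid monoid.one_closed)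
    moreover have "restrict c (top_chains n) = (\<lambda>\<sigma>\<in>top_chains n. \<one>\<^bsub>F (vertex \<sigma> 0)\<^esub>)"
      by (rule restrict_ext) (auto simp: c top_chains_def Ch_minus_top)
    ultimately show ?thesis by (simp add: kernel_def)
  qed
  show "c \<in> ?L" if "c \<in> ?R" for c
  proof -
    have c: "c \<in> (\<Pi>\<^sub>E \<sigma>\<in>Ch UNIV n. carrier (F (vertex \<sigma> 0)))"
      and one: "restrict c (top_chains n) = (\<lambda>\<sigma>\<in>top_chains n. \<one>\<^bsub>F (vertex \<sigma> 0)\<^esub>)"
      using that by (auto simp: kernel_def C_group_eq carrier_dsum)
    have "c \<sigma> = \<one>\<^bsub>F (vertex \<sigma> 0)\<^esub>" if "\<sigma> \<in> top_chains n" for \<sigma>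
      using fun_cong [OF one, of \<sigma>] that by simp
    then have "c = (\<lambda>\<sigma>\<in>Ch UNIV n. if \<sigma> \<in> Ch ?A n then restrict c (Ch ?A n) \<sigma> else \<one>\<^bsub>F (vertex \<sigma> 0)\<^esub>)"
      using c by (intro ext) (auto simp: Ch_minus_top top_chains_def PiE_def extensional_def)
    moreover have "restrict c (Ch ?A n) \<in> carrier (C_group ?A F n)"
      using c by (auto simp: carrier_A Ch_minus_top)
    ultimately show ?thesis unfolding C_sub_def by blast
  qed
qed

lemma rel_homology_iso:
  "rel_homology UNIV (UNIV - {Orderings.top}) F f n \<cong>
    homology (\<lambda>n. dsum (\<lambda>\<sigma>. vertex \<sigma> 0) (top_chains n)) top_realize n"
  unfolding rel_homology_def
proof (rule quotient_homology_iso [where p = "\<lambda>n c. restrict c (top_chains n)"])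
  let ?K = "\<lambda>n. dsum (\<lambda>\<sigma>. vertex \<sigma> 0) (top_chains n :: 'a set set)"
  show "chain_complex ?K top_realize"
    by (rule resolution_chain_complex) (rule top_chains_resolution)
  show "(\<lambda>c. restrict c (top_chains n)) \<in> hom (C_group UNIV F n) (?K n)" for n
    by (rule homI) (auto simp: C_group_eq carrier_dsum top_chains_def intro!: restrict_ext)
  show "(\<lambda>c. restrict c (top_chains n)) ` carrier (C_group UNIV F n) = carrier (?K n)" for n
  proof (intro equalityI subsetI)
    fix c assume c: "c \<in> carrier (?K n)"
    \<comment> \<open>Extension by the neutral element is a preimage under restriction.\<close>
    let ?c = "\<lambda>\<sigma>\<in>Ch UNIV n. if \<sigma> \<in> top_chains n then c \<sigma> else \<one>\<^bsub>F (vertex \<sigma> 0)\<^esub>"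
    have "?c \<in> carrier (C_group UNIV F n)"
      using c by (auto simp: C_group_eq carrier_dsum group.is_monoid monoid.one_closed)
    moreover have "c = restrict ?c (top_chains n)"
      using c by (intro ext) (auto simp: carrier_dsum top_chains_def PiE_def extensional_def)
    ultimately show "c \<in> (\<lambda>c. restrict c (top_chains n)) ` carrier (C_group UNIV F n)" by blast
  qed (auto simp: C_group_eq carrier_dsum top_chains_def split: if_splits)
qed (simp_all only: comm_group_C_group C_diff_closed C_sub_eq_kernel restrict_C_diff)

end

section \<open>The complex of covers as a realized matrix complex\<close>

locale cube_diagram = ab_diagram F f
  for F :: "'a::{finite, boolean_algebra} \<Rightarrow> 'b monoid" and f +
  fixes R :: "('a \<times> 'a) set"
  assumes R: "linear_order_on atoms R"
begin

lemma E_index: "(if n < 0 then {} else D n) = (D n :: 'a set)"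
  by (simp add: D_neg)

lemma E_group_eq: "E_group F = (\<lambda>n. dsum (\<lambda>x. x) (D n))"
  unfolding E_group_def E_index ..

lemma E_incl_closed:
  assumes "g \<in> carrier (F y)"
  shows "E_incl F n y g \<in> carrier (dsum (\<lambda>x. x) (D n))"
  unfolding E_incl_def E_index
  using summand_incl_closed [of "D n" y g "\<lambda>x. x"] assms by simp

lemma E_incl_apply: "y \<in> D n \<Longrightarrow> E_incl F n z g y = (if y = z then g else \<one>\<^bsub>F y\<^esub>)"
  unfolding E_incl_def E_index by (simp add: summand_incl_def)

lemma E_diff_summand_closed:
  assumes "g \<in> carrier (F x)"
  shows "E_diff_summand R F f n x g \<in> carrier (dsum (\<lambda>x. x) (D (n - 1)))"
proof -
  interpret G: comm_group "dsum (\<lambda>x. x) (D (n - 1))" by (rule comm_group_dsum)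
  show ?thesis
    unfolding E_diff_summand_def E_group_eq
    using assms by (intro G.finprod_closed)
      (auto simp: covered_by_def intro!: E_incl_closed group.int_pow_closed f_closed)
qed

lemma E_diff_summand_apply:
  assumes g: "g \<in> carrier (F x)" and y: "y \<in> D (n - 1)"
  shows "E_diff_summand R F f n x g y = act x y (cube_diff R x y) g"
proof -
  interpret G: comm_group "F y" by simp
  let ?t = "act x y (cube_diff R x y) g"
  have "E_diff_summand R F f n x g y = finprod (F y)
      (\<lambda>z. E_incl F (n - 1) z (f x z g [^]\<^bsub>F z\<^esub> cover_sign R x z) y) {z. covered_by x z}"
    unfolding E_diff_summand_def E_group_eq
    using g y by (intro finprod_dsum)
      (auto simp: covered_by_def intro!: E_incl_closed group.int_pow_closed f_closed)
  \<comment> \<open>Coordinate \<open>y\<close> sees only the summand \<open>z = y\<close>, and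
    nothing at all if \<open>y\<close> does not cover \<open>x\<close>.\<close>
  also have "\<dots> = finprod (F y) (\<lambda>z. if y = z then ?t else \<one>\<^bsub>F y\<^esub>) {z. covered_by x z}"
    using y act_closed [OF g]
    by (intro G.finprod_cong')
      (auto simp: E_incl_apply act_def cube_diff_def covered_by_def)
  also have "\<dots> = ?t"
  proof (cases "covered_by x y")
    case True
    then show ?thesis using act_closed [OF g] by (intro G.finprod_singleton) auto
  next
    case False
    then have "finprod (F y) (\<lambda>z. if y = z then ?t else \<one>\<^bsub>F y\<^esub>) {z. covered_by x z} = \<one>\<^bsub>F y\<^esub>"
      by (intro G.finprod_one_eqI) auto
    then show ?thesis using False by (simp add: cube_diff_def)
  qed
  finally show ?thesis .
qed

lemma E_diff_eq:
  assumes c: "c \<in> carrier (E_group F n)"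
  shows "E_diff R F f n c = realize (\<lambda>x. x) (\<lambda>x. x) (D n) (D (n - 1)) (cube_diff R) c"
proof -
  have cx: "c x \<in> carrier (F x)" if "x \<in> D n" for x
    using c that by (auto simp: E_group_eq carrier_dsum)
  have closed: "(\<lambda>x. E_diff_summand R F f n x (c x)) \<in> D n \<rightarrow> carrier (dsum (\<lambda>x. x) (D (n - 1)))"
    using cx E_diff_summand_closed by auto
  have eq: "E_diff R F f n c
      = finprod (dsum (\<lambda>x. x) (D (n - 1))) (\<lambda>x. E_diff_summand R F f n x (c x)) (D n)"
    unfolding E_diff_def E_index E_group_eq
    by (rule gfinprod_finprod [OF comm_group_dsum _ closed]) simp
  interpret G: comm_group "dsum (\<lambda>x. x) (D (n - 1))" by (rule comm_group_dsum)
  have "E_diff R F f n c \<in> carrier (dsum (\<lambda>x. x) (D (n - 1)))"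
    unfolding eq using closed by (rule G.finprod_closed)
  then have ext: "E_diff R F f n c \<in> extensional (D (n - 1))"
    by (simp add: carrier_dsum PiE_def)
  show ?thesis
  proof (rule extensionalityI [OF ext])
    show "realize (\<lambda>x. x) (\<lambda>x. x) (D n) (D (n - 1)) (cube_diff R) c \<in> extensional (D (n - 1))"
      by (simp add: realize_def)
    fix y :: 'a assume y: "y \<in> D (n - 1)"
    interpret Fy: comm_group "F y" by simp
    have "E_diff R F f n c y = finprod (F y) (\<lambda>x. E_diff_summand R F f n x (c x) y) (D n)"
      unfolding eq using y closed by (intro finprod_dsum) auto
    also have "\<dots> = finprod (F y) (\<lambda>x. act x y (cube_diff R x y) (c x)) (D n)"
      using cx y by (intro Fy.finprod_cong') (auto simp: E_diff_summand_apply intro: act_closed)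
    finally show "E_diff R F f n c y = realize (\<lambda>x. x) (\<lambda>x. x) (D n) (D (n - 1)) (cube_diff R) c y"
      using y by (simp add: realize_def)
  qed
qed

lemma homology_E:
  "homology (E_group F) (E_diff R F f) n = homology (\<lambda>n. dsum (\<lambda>x. x) (D n))
     (\<lambda>n. realize (\<lambda>x. x) (\<lambda>x. x) (D n) (D (n - 1)) (cube_diff R)) n"
  unfolding E_group_eq [symmetric] using E_diff_eq by (rule homology_cong)

end

theorem theorem4p6:
  fixes F :: "'a::{finite, boolean_algebra} \<Rightarrow> 'b monoid"
    and f :: "'a \<Rightarrow> 'a \<Rightarrow> 'b \<Rightarrow> 'b"
    and R :: "('a \<times> 'a) set"
    and n :: int
  assumes "linear_order_on atoms R"
    and "ab_functor UNIV F f"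
  shows "rel_homology UNIV (UNIV - {Orderings.top}) F f n \<cong> homology (E_group F) (E_diff R F f) n"
proof -
  interpret ab_diagram F f using assms(2) by (rule ab_diagram.intro)
  interpret top_diagram F f ..
  interpret cube_diagram F f R by unfold_locales (rule assms(1))
  show ?thesis
    unfolding homology_E
    using rel_homology_iso resolution_homology_iso [OF top_chains_resolution cube_resolution [OF assms(1)]]
    by (rule iso_trans)
qed

end
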